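(* Let $(X,d,A)$ be a metric pair with $A\neq\emptyset$ and assume that the pair $(X,A)$ is boundedly compact. Let $T:\mathrm{Lip}_c(X,A)\to\mathbb{R}$ be an order bounded, sequentially order continuous linear functional such that both $T$ and $|T|$ are bounded. Then there exist $\mu,\nu\in\mathcal{M}_1^+(X,A)$ such that $T(f)=\int_X f\,d(\mu-\nu)$ for all $f\in\mathrm{Lip}_c(X,A)$. Moreover, $\mu$ and $\nu$ can be chosen uniquely such that, for all $f\in\mathrm{Lip}_c^+(X,A)$, $$\inf\Bigl\{\int_X g\,d\mu+\int_X h\,d\nu\ \Big|\ g+h=f,\ g,h\in\mathrm{Lip}_c^+(X,A)\Bigr\}=0.$$
   Context: A metric pair $(X,d,A)$ is a metric space $(X,d)$ with a closed subset $A\subset X$; $d_A(x)=\inf_{a\in A}d(x,a)$. The metric pair $(X,A)$ is boundedly compact if $X$ is locally compact and $\sigma$-compact and for each $x\in X\setminus A$ and all $\varepsilon,r>0$, the set $\overline{B}_r(x)\cap\overline{A_\varepsilon}$ is compact, where $A_\varepsilon=\{y\in X: d_A(y)>\varepsilon\}$. Measures take values in $[0,\infty]$. Let $\mathcal{B}^+(X)$ be the commutative monoid of Borel measures on $X$ and $\mathcal{B}^+(X,A)=\mathcal{B}^+(X)/\mathcal{B}^+(A)$ the quotient monoid: $\mu\sim\nu$ iff $\mu+\sigma=\nu+\tau$ for some Borel measures $\sigma,\tau$ concentrated on $A$; equivalently $\mu,\nu$ agree on Borel subsets of $X\setminus A$, so relative Borel measures correspond bijectively to Borel measures on $X\setminus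 A$. For $f$ vanishing on $A$, $\int_X f\,d\mu$ is well defined, and $\int f\,d(\mu-\nu)=\int f\,d\mu-\int f\,d\nu$. $\mu$ is tight if $\mu(E)=\sup\{\mu(K): K\subset E \text{ compact}\}$ for every Borel $E\subset X\setminus A$. $\mathcal{M}_1^+(X,A)$ is the set of tight $\mu\in\mathcal{B}^+(X,A)$ with $\int d_A\,d\mu<\infty$. $\mathrm{Lip}_c(X,A)$ is the Riesz space (vector lattice) of compactly supported Lipschitz functions $f:X\to\mathbb{R}$ with $f|_A=0$, ordered pointwise and normed by the Lipschitz number $L(f)$ (least Lipschitz constant); $\mathrm{Lip}_c^+(X,A)$ is its set of nonnegative elements. A linear functional $T$ is bounded if $|T(f)|\le M\,L(f)$ for some $M$ and all $f$; it is order bounded if it maps order intervals to bounded sets. Order bounded functionals form a Riesz space ordered by the cone of positive functionals, and $|T|=T\vee(-T)$ there. In a Riesz space $E$, $x_n\xrightarrow{o}0$ means there is a decreasing sequence $(y_n)$ in $E$ with infimum $0$ in $E$ and $|x_n|\le y_n$; $T$ is sequentially order continuous if $x_n\xrightarrow{o}0$ implies $T(x_n)\to0$. *)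

theory Defs
  imports "HOL-Analysis.Analysis"
begin

section \<open>Boundedly compact metric pairs\<close>

text \<open>
  The underlying space is a whole type of class \<^class>\<open>metric_space\<close>; a metric pair is such
  a type with a closed set \<open>A\<close>, and \<open>d\<^sub>A(x)\<close> is \<^term>\<open>infdist x A\<close> (for nonempty \<open>A\<close>).
\<close>

definition boundedly_compact :: "'a::metric_space set \<Rightarrow> bool" where
  "boundedly_compact A \<longleftrightarrow>
     locally_compact_space (euclidean :: 'a topology) \<and>
     (\<exists>K :: nat \<Rightarrow> 'a set. (\<forall>n. compact (K n)) \<and> (\<Union>n. K n) = UNIV) \<and>
     (\<forall>x\<in>- A. \<forall>\<epsilon>>0. \<forall>r>0. compact (cball x r \<inter> closure {y. infdist y A > \<epsilon>}))"

section \<open>Relative Borel measures\<close>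

definition borel_measures :: "'a::topological_space measure set" where
  "borel_measures = {\<mu>. sets \<mu> = sets borel}"

definition concentrated_on :: "'a measure \<Rightarrow> 'a set \<Rightarrow> bool" where
  "concentrated_on \<mu> A \<longleftrightarrow> emeasure \<mu> (- A) = 0"

text \<open>
  The congruence \<open>\<mu> + \<sigma> = \<nu> + \<tau>\<close> defining the quotient monoid, with Borel measures compared set
  by set because the type of measures carries no addition.
\<close>

definition rel_measure_rel :: "'a::topological_space set \<Rightarrow> ('a measure \<times> 'a measure) set" where
  "rel_measure_rel A =
     {(\<mu>, \<nu>). \<mu> \<in> borel_measures \<and> \<nu> \<in> borel_measures \<and>
       (\<exists>\<sigma>\<in>borel_measures. \<exists>\<tau>\<in>borel_measures. concentrated_on \<sigma> A \<and> concentrated_on \<tau> A \<and>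
          (\<forall>E\<in>sets borel. emeasure \<mu> E + emeasure \<sigma> E = emeasure \<nu> E + emeasure \<tau> E))}"

definition rel_measures :: "'a::topological_space set \<Rightarrow> 'a measure set set" where
  "rel_measures A = borel_measures // rel_measure_rel A"

lemma rel_measure_rel_iff:
  assumes "closed A"
  shows "(\<mu>, \<nu>) \<in> rel_measure_rel A \<longleftrightarrow> \<mu> \<in> borel_measures \<and> \<nu> \<in> borel_measures \<and>
           (\<forall>E\<in>sets borel. E \<subseteq> - A \<longrightarrow> emeasure \<mu> E = emeasure \<nu> E)"
proof (intro iffI conjI ballI impI; (elim conjE)?)
  fix E :: "'a set"
  assume r: "(\<mu>, \<nu>) \<in> rel_measure_rel A" and E: "E \<in> sets borel" "E \<subseteq> - A"
  then obtain \<sigma> \<tau> where *: "\<sigma> \<in> borel_measures" "\<tau> \<in> borel_measures"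
      "emeasure \<sigma> (- A) = 0" "emeasure \<tau> (- A) = 0"
      "emeasure \<mu> E + emeasure \<sigma> E = emeasure \<nu> E + emeasure \<tau> E"
    unfolding rel_measure_rel_def concentrated_on_def by blast
  have "- A \<in> sets borel" using assms by auto
  then have "emeasure \<sigma> E = 0" "emeasure \<tau> E = 0"
    using * E emeasure_mono[of E "- A" \<sigma>] emeasure_mono[of E "- A" \<tau>]
    by (auto simp: borel_measures_def)
  then show "emeasure \<mu> E = emeasure \<nu> E" using * by simp
next
  assume \<mu>: "\<mu> \<in> borel_measures" and \<nu>: "\<nu> \<in> borel_measures"
    and eq: "\<forall>E\<in>sets borel. E \<subseteq> - A \<longrightarrow> emeasure \<mu> E = emeasure \<nu> E"
  have A: "A \<in> sets borel" using assms by simp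
  have res: "emeasure (density M (indicator A)) E = emeasure M (A \<inter> E)"
    if "M \<in> borel_measures" "E \<in> sets borel" for M and E :: "'a set"
    using that A by (intro emeasure_restricted) (auto simp: borel_measures_def)
  have split: "emeasure M E = emeasure M (E - A) + emeasure M (A \<inter> E)"
    if "M \<in> borel_measures" "E \<in> sets borel" for M and E :: "'a set"
  proof -
    have "(E - A) \<union> (A \<inter> E) = E" "(E - A) \<inter> (A \<inter> E) = {}" by blast+
    then show ?thesis
      using that A plus_emeasure[of "E - A" M "A \<inter> E"] by (auto simp: borel_measures_def)
  qed
  have conc: "concentrated_on (density M (indicator A)) A" if "M \<in> borel_measures" for M
    using res[OF that, of "- A"] A by (auto simp: concentrated_on_def)
  have sum: "emeasure \<mu> E + emeasure (density \<nu> (indicator A)) E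
          = emeasure \<nu> E + emeasure (density \<mu> (indicator A)) E" if E: "E \<in> sets borel" for E
  proof -
    have "emeasure \<mu> (E - A) = emeasure \<nu> (E - A)" using eq E A by auto
    then show ?thesis
      using split[OF \<mu> E] split[OF \<nu> E] res[OF \<mu> E] res[OF \<nu> E] by (simp add: ac_simps)
  qed
  have "density \<mu> (indicator A) \<in> borel_measures" "density \<nu> (indicator A) \<in> borel_measures"
    using \<mu> \<nu> by (simp_all add: borel_measures_def)
  with \<mu> \<nu> sum conc[OF \<mu>] conc[OF \<nu>] show "(\<mu>, \<nu>) \<in> rel_measure_rel A"
    unfolding rel_measure_rel_def by blast
qed (auto simp: rel_measure_rel_def)

lemma equiv_rel_measure_rel:
  assumes "closed A"
  shows "equiv borel_measures (rel_measure_rel A)"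
  by (rule equivI)
     (auto simp: refl_on_def sym_def trans_def rel_measure_rel_iff[OF assms] simp del: split_paired_All)

text \<open>
  The value shared by all representatives of the class \<open>M\<close>; it exists for Borel functions
  vanishing on \<open>A\<close>.
\<close>

definition rel_integral :: "'a measure set \<Rightarrow> ('a \<Rightarrow> real) \<Rightarrow> real" where
  "rel_integral M f = the_elem ((\<lambda>\<mu>. \<integral>x. f x \<partial>\<mu>) ` M)"

lemma rel_measure_rel_integral_eq:
  assumes "closed A" and rel: "(\<mu>, \<nu>) \<in> rel_measure_rel A"
    and f: "f \<in> borel_measurable borel" "\<And>x. x \<in> A \<Longrightarrow> f x = (0::real)"
  shows "(\<integral>x. f x \<partial>\<mu>) = (\<integral>x. f x \<partial>\<nu>)"
proof -
  let ?B = "indicator (- A) :: 'a \<Rightarrow> real"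
  have B: "- A \<in> sets borel" using assms(1) by auto
  have s: "sets \<mu> = sets borel" "sets \<nu> = sets borel"
    and eq: "\<And>E. E \<in> sets borel \<Longrightarrow> E \<subseteq> - A \<Longrightarrow> emeasure \<mu> E = emeasure \<nu> E"
    using rel rel_measure_rel_iff[OF assms(1)] by (auto simp: borel_measures_def)
  have int: "integral\<^sup>L M f = integral\<^sup>L (density M ?B) f" if M: "sets M = sets borel" for M
  proof -
    have "f \<in> borel_measurable M" "?B \<in> borel_measurable M"
      using f(1) B by (auto simp: measurable_cong_sets[OF M refl])
    then have "integral\<^sup>L (density M ?B) f = integral\<^sup>L M (\<lambda>x. ?B x *\<^sub>R f x)"
      by (intro integral_density) auto
    moreover have "(\<lambda>x. ?B x *\<^sub>R f x) = f"
      using f(2) by (auto simp: indicator_def fun_eq_iff)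
    ultimately show ?thesis by simp
  qed
  have "density \<mu> ?B = density \<nu> ?B"
  proof (rule measure_eqI)
    fix E assume "E \<in> sets (density \<mu> ?B)"
    then have E: "E \<in> sets borel" using s by simp
    have "emeasure \<mu> (- A \<inter> E) = emeasure \<nu> (- A \<inter> E)"
      using E B by (intro eq) auto
    then show "emeasure (density \<mu> ?B) E = emeasure (density \<nu> ?B) E"
      using E B s by (simp add: emeasure_restricted ennreal_indicator)
  qed (simp add: s)
  then show ?thesis using int[OF s(1)] int[OF s(2)] by simp
qed

text \<open>
  Both conditions below only involve Borel subsets of \<open>- A\<close>, respectively a function vanishing
  on \<open>A\<close>, so all representatives of a class satisfy them or none does.
\<close>

definition tight_off :: "'a::topological_space set \<Rightarrow> 'a measure \<Rightarrow> bool" where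
  "tight_off A \<mu> \<longleftrightarrow>
     (\<forall>E\<in>sets borel. E \<subseteq> - A \<longrightarrow> emeasure \<mu> E = (SUP K\<in>{K. compact K \<and> K \<subseteq> E}. emeasure \<mu> K))"

definition M1_plus :: "'a::metric_space set \<Rightarrow> 'a measure set set" where
  "M1_plus A =
     {M \<in> rel_measures A. \<forall>\<mu>\<in>M. tight_off A \<mu> \<and> (\<integral>\<^sup>+x. ennreal (infdist x A) \<partial>\<mu>) < \<infinity>}"

section \<open>Compactly supported Lipschitz functions\<close>

definition Lipc :: "'a::metric_space set \<Rightarrow> ('a \<Rightarrow> real) set" where
  "Lipc A = {f. (\<exists>C. C-lipschitz_on UNIV f) \<and> compact (closure {x. f x \<noteq> 0}) \<and> (\<forall>x\<in>A. f x = 0)}"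

definition Lipc_pos :: "'a::metric_space set \<Rightarrow> ('a \<Rightarrow> real) set" where
  "Lipc_pos A = {f \<in> Lipc A. \<forall>x. 0 \<le> f x}"

definition lip_number :: "('a::metric_space \<Rightarrow> real) \<Rightarrow> real" where
  "lip_number f = Inf {C. C-lipschitz_on UNIV f}"

text \<open>
  Convergence in order to \<open>0\<close> in the Riesz space \<^term>\<open>Lipc A\<close>.  The infimum of \<open>y\<close> is taken
  in \<^term>\<open>Lipc A\<close> and may differ from the pointwise infimum.
\<close>

definition order_null :: "'a::metric_space set \<Rightarrow> (nat \<Rightarrow> 'a \<Rightarrow> real) \<Rightarrow> bool" where
  "order_null A u \<longleftrightarrow>
     (\<exists>y. (\<forall>n. y n \<in> Lipc A) \<and> decseq y \<and>
          (\<forall>n. (\<lambda>x. 0) \<le> y n) \<and> (\<forall>z\<in>Lipc A. (\<forall>n. z \<le> y n) \<longrightarrow> z \<le> (\<lambda>x. 0)) \<and>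
          (\<forall>n. (\<lambda>x. \<bar>u n x\<bar>) \<le> y n))"

section \<open>Functionals\<close>

text \<open>
  A functional on \<^term>\<open>Lipc A\<close> is a HOL function on all of \<^typ>\<open>'a \<Rightarrow> real\<close> whose values outside
  \<^term>\<open>Lipc A\<close> are irrelevant.
\<close>

definition linear_functional :: "'a::metric_space set \<Rightarrow> (('a \<Rightarrow> real) \<Rightarrow> real) \<Rightarrow> bool" where
  "linear_functional A T \<longleftrightarrow>
     (\<forall>f\<in>Lipc A. \<forall>g\<in>Lipc A. T (\<lambda>x. f x + g x) = T f + T g) \<and>
     (\<forall>c. \<forall>f\<in>Lipc A. T (\<lambda>x. c * f x) = c * T f)"

definition bounded_functional :: "'a::metric_space set \<Rightarrow> (('a \<Rightarrow> real) \<Rightarrow> real) \<Rightarrow> bool" where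
  "bounded_functional A T \<longleftrightarrow> (\<exists>M. \<forall>f\<in>Lipc A. \<bar>T f\<bar> \<le> M * lip_number f)"

definition order_bounded :: "'a::metric_space set \<Rightarrow> (('a \<Rightarrow> real) \<Rightarrow> real) \<Rightarrow> bool" where
  "order_bounded A T \<longleftrightarrow>
     (\<forall>u\<in>Lipc A. \<forall>v\<in>Lipc A. bounded (T ` {f \<in> Lipc A. u \<le> f \<and> f \<le> v}))"

definition seq_order_continuous :: "'a::metric_space set \<Rightarrow> (('a \<Rightarrow> real) \<Rightarrow> real) \<Rightarrow> bool" where
  "seq_order_continuous A T \<longleftrightarrow>
     (\<forall>u. (\<forall>n. u n \<in> Lipc A) \<longrightarrow> order_null A u \<longrightarrow> (\<lambda>n. T (u n)) \<longlonglongrightarrow> 0)"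

definition functional_le ::
  "'a::metric_space set \<Rightarrow> (('a \<Rightarrow> real) \<Rightarrow> real) \<Rightarrow> (('a \<Rightarrow> real) \<Rightarrow> real) \<Rightarrow> bool" where
  "functional_le A S T \<longleftrightarrow> (\<forall>f\<in>Lipc_pos A. S f \<le> T f)"

definition is_functional_sup ::
  "'a::metric_space set \<Rightarrow> (('a \<Rightarrow> real) \<Rightarrow> real) \<Rightarrow> (('a \<Rightarrow> real) \<Rightarrow> real) \<Rightarrow>
     (('a \<Rightarrow> real) \<Rightarrow> real) \<Rightarrow> bool" where
  "is_functional_sup A S T R \<longleftrightarrow>
     linear_functional A R \<and> order_bounded A R \<and> functional_le A S R \<and> functional_le A T R \<and>
     (\<forall>Q. linear_functional A Q \<and> order_bounded A Q \<and> functional_le A S Q \<and> functional_le A T Q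
          \<longrightarrow> functional_le A R Q)"

text \<open>
  \<open>|T| = T \<or> (-T)\<close> in the Riesz space of order bounded functionals, where it exists for order
  bounded linear \<open>T\<close>.  Extensionality fixes the irrelevant values outside \<^term>\<open>Lipc A\<close> and so
  makes the supremum a unique HOL function.
\<close>

definition functional_abs ::
  "'a::metric_space set \<Rightarrow> (('a \<Rightarrow> real) \<Rightarrow> real) \<Rightarrow> ('a \<Rightarrow> real) \<Rightarrow> real" where
  "functional_abs A T =
     (THE R. R \<in> extensional (Lipc A) \<and> is_functional_sup A T (\<lambda>f. - T f) R)"

end

theory Submission
  imports Defs
begin

text \<open>
  Write \<open>P f = sup {T g | 0 \<le> g \<le> f}\<close> for \<open>f \<ge> 0\<close>; this is the positive part of \<open>T\<close>, and with
  \<open>N = P - T\<close> one has \<open>|T| = P + N\<close>, so \<open>P\<close> and \<open>N\<close> are bounded.  Order continuity passes from \<open>T\<close>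
  to \<open>P\<close> and \<open>N\<close>, which makes both of them Daniell integrals, hence integrals with respect to Borel
  measures.  Bounded compactness provides an increasing sequence of 1-Lipschitz functions in
  \<open>Lip\<^sub>c(X,A)\<close> with limit \<open>d\<^sub>A\<close>: boundedness then gives \<open>\<integral> d\<^sub>A < \<infinity>\<close>, and multiples of such functions cut off
  by the distance to a closed set approximate indicators of open subsets of \<open>X - A\<close> from below.
  For \<open>f \<ge> 0\<close> and \<open>T = \<mu> - \<nu>\<close> the infimum in the statement equals \<open>\<integral> f d\<mu> - P f\<close>, so that
  it vanishes exactly when \<open>\<mu>\<close> represents \<open>P\<close>.
\<close>

text \<open>Boundedness of \<open>|T|\<close>, and not only of \<open>T\<close>, is what controls
  \<open>P\<close> and \<open>N\<close> one at a time: cancellation in \<open>P - N\<close> could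
  hide that each of them integrates the distance to \<open>A\<close> to infinity. The obstacle on
  the measure side is that nonzero constants never lie in the lattice and every function in it
  vanishes on \<open>A\<close>, so the whole space has no countable cover by positivity sets of its
  functions. The construction therefore starts from an outer measure defined by countable series of
  majorants, where a set without a cover simply has measure infinity, and closure under
  \<open>min f 1\<close> takes the place of the constants. Finiteness of the integral of the
  distance to \<open>A\<close> is used twice. It makes every bounded region at positive distance
  from \<open>A\<close> of finite measure, which lets outer regularity be turned into tightness by
  taking complements inside a compact piece. It also lets compact sets be measured as differences of
  open sets of finite measure, on which the uniqueness argument rests.\<close>

locale function_lattice =
  fixes L :: "('a \<Rightarrow> real) set"
  assumes zero_mem: "(\<lambda>x. 0) \<in> L"
    and add_mem: "f \<in> L \<Longrightarrow> g \<in> L \<Longrightarrow> (\<lambda>x. f x + g x) \<in> L"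
    and scale_mem: "f \<in> L \<Longrightarrow> (\<lambda>x. c * f x) \<in> L"
    and min_mem: "f \<in> L \<Longrightarrow> g \<in> L \<Longrightarrow> (\<lambda>x. min (f x) (g x)) \<in> L"
begin

lemma uminus_mem: "f \<in> L \<Longrightarrow> (\<lambda>x. - f x) \<in> L"
  using scale_mem[of f "-1"] by simp

lemma diff_mem: "f \<in> L \<Longrightarrow> g \<in> L \<Longrightarrow> (\<lambda>x. f x - g x) \<in> L"
  using add_mem[OF _ uminus_mem, of f g] by simp

lemma max_mem: "f \<in> L \<Longrightarrow> g \<in> L \<Longrightarrow> (\<lambda>x. max (f x) (g x)) \<in> L"
  using uminus_mem[OF min_mem[OF uminus_mem uminus_mem], of f g]
  by (simp add: minus_min_eq_max)

lemma sum_mem: "(\<And>i. i \<in> S \<Longrightarrow> f i \<in> L) \<Longrightarrow> (\<lambda>x. \<Sum>i\<in>S. f i x) \<in> L"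
  by (induction S rule: infinite_finite_induct) (auto intro: zero_mem add_mem)

end

section \<open>From a Daniell integral to an outer measure and back to integrals\<close>

locale daniell_integral = function_lattice L for L :: "('a \<Rightarrow> real) set" +
  fixes I :: "('a \<Rightarrow> real) \<Rightarrow> real"
  assumes min_one_mem: "f \<in> L \<Longrightarrow> (\<lambda>x. min (f x) 1) \<in> L"
    and bounded_above: "f \<in> L \<Longrightarrow> \<exists>B. \<forall>x. f x \<le> B"
    and I_add: "f \<in> L \<Longrightarrow> g \<in> L \<Longrightarrow> I (\<lambda>x. f x + g x) = I f + I g"
    and I_scale: "f \<in> L \<Longrightarrow> I (\<lambda>x. c * f x) = c * I f"
    and I_nonneg: "f \<in> L \<Longrightarrow> (\<And>x. 0 \<le> f x) \<Longrightarrow> 0 \<le> I f"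
    and I_decseq: "(\<And>n. u n \<in> L) \<Longrightarrow> (\<And>x. decseq (\<lambda>n. u n x)) \<Longrightarrow>
      (\<And>x. (\<lambda>n. u n x) \<longlonglongrightarrow> 0) \<Longrightarrow> (\<lambda>n. I (u n)) \<longlonglongrightarrow> 0"
begin

lemma I_diff: "f \<in> L \<Longrightarrow> g \<in> L \<Longrightarrow> I (\<lambda>x. f x - g x) = I f - I g"
  using I_add[OF _ uminus_mem, of f g] I_scale[of g "-1"] by simp

lemma I_zero: "I (\<lambda>x. 0) = 0"
  using I_scale[OF zero_mem, of 0] by simp

lemma I_mono: "f \<in> L \<Longrightarrow> g \<in> L \<Longrightarrow> (\<And>x. f x \<le> g x) \<Longrightarrow> I f \<le> I g"
  using I_diff[of g f] I_nonneg[OF diff_mem, of g f] by simp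

lemma I_sum: "(\<And>i. i \<in> S \<Longrightarrow> f i \<in> L) \<Longrightarrow> I (\<lambda>x. \<Sum>i\<in>S. f i x) = (\<Sum>i\<in>S. I (f i))"
  by (induction S rule: infinite_finite_induct) (auto simp: I_zero I_add sum_mem)

text \<open>Stone's condition \<open>min_one_mem\<close>, rescaled to every positive height; it is
  what allows a function to be sliced into horizontal layers.\<close>

lemma min_const_mem:
  assumes "f \<in> L" "0 < c"
  shows "(\<lambda>x. min (f x) c) \<in> L"
proof -
  have "(\<lambda>x. min (f x) c) = (\<lambda>x. c * min (inverse c * f x) 1)"
    using assms(2) by (auto simp: min_def field_simps)
  then show ?thesis using assms(1) by (simp add: scale_mem min_one_mem)
qed

definition Lp where "Lp = {f \<in> L. \<forall>x. 0 \<le> f x}"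

lemma LpD: "f \<in> Lp \<Longrightarrow> f \<in> L" "f \<in> Lp \<Longrightarrow> 0 \<le> f x"
  by (auto simp: Lp_def)

lemma LpI: "f \<in> L \<Longrightarrow> (\<And>x. 0 \<le> f x) \<Longrightarrow> f \<in> Lp"
  by (auto simp: Lp_def)

lemma I_Lp_nonneg: "f \<in> Lp \<Longrightarrow> 0 \<le> I f"
  by (auto simp: Lp_def intro: I_nonneg)

text \<open>The positive part of \<open>h\<close> minus the partial sums decreases pointwise to 0,
  so Daniell continuity makes its integral negligible, and \<open>h\<close> is at most that part
  plus a partial sum. This is the reason why the upper integral below extends \<open>I\<close> and
  does not fall below it.\<close>

lemma I_le_suminf:
  assumes h: "h \<in> L" and g: "\<And>i. g i \<in> Lp"
    and le: "\<And>x. ennreal (h x) \<le> (\<Sum>i. ennreal (g i x))"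
  shows "ennreal (I h) \<le> (\<Sum>i. ennreal (I (g i)))"
proof -
  define r where "r n x = max 0 (h x - (\<Sum>i<n. g i x))" for n x
  have sL: "(\<lambda>x. \<Sum>i<n. g i x) \<in> L" for n using g LpD by (intro sum_mem) auto
  have rL: "r n \<in> L" for n
    unfolding r_def[abs_def] by (intro max_mem zero_mem diff_mem h sL)
  have r0: "(\<lambda>n. I (r n)) \<longlonglongrightarrow> 0"
  proof (rule I_decseq[OF rL])
    fix x
    show "decseq (\<lambda>n. r n x)"
    proof (rule decseq_SucI)
      show "r (Suc n) x \<le> r n x" for n
        using LpD(2)[OF g, of n x] by (auto simp: r_def)
    qed
    show "(\<lambda>n. r n x) \<longlonglongrightarrow> 0"
    proof (rule order_tendstoI)
      fix a :: real assume "0 < a"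
      show "\<forall>\<^sub>F n in sequentially. r n x < a"
      proof (rule ccontr)
        assume "\<not> ?thesis"
        then have inf: "\<exists>\<^sub>F n in sequentially. a \<le> r n x"
          by (simp add: frequently_def not_le)
        \<comment> \<open>A remainder of at least \<open>a\<close> at arbitrarily late indices
          bounds every partial sum, since the partial sums increase.\<close>
        have "(\<Sum>i<n. g i x) \<le> h x - a" for n
        proof -
          obtain m where "m \<ge> n" "a \<le> r m x"
            using inf by (auto simp: frequently_sequentially)
          moreover have "(\<Sum>i<n. g i x) \<le> (\<Sum>i<m. g i x)"
            using \<open>m \<ge> n\<close> LpD(2)[OF g] by (intro sum_mono2) auto
          ultimately show ?thesis using \<open>0 < a\<close> by (auto simp: r_def max_def split: if_splits)
        qed note b = this
        then have "(\<Sum>i<n. ennreal (g i x)) \<le> ennreal (h x - a)" for n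
          using LpD(2)[OF g] by (simp add: sum_ennreal ennreal_leI)
        then have "(\<Sum>i. ennreal (g i x)) \<le> ennreal (h x - a)"
          by (intro suminf_le_const) auto
        with le[of x] have "ennreal (h x) \<le> ennreal (h x - a)" by (rule order_trans)
        \<comment> \<open>The empty partial sum excludes that \<open>ennreal\<close> truncates both
          sides to 0, where the inequality would be no contradiction.\<close>
        moreover have "0 \<le> h x - a" using b[of 0] by simp
        ultimately show False using \<open>0 < a\<close> by (simp add: ennreal_le_iff)
      qed
    qed (auto simp: r_def less_max_iff_disj intro: always_eventually)
  qed
  show ?thesis
  proof (rule ennreal_le_epsilon)
    fix e :: real assume "0 < e"
    then obtain n where n: "I (r n) < e"
      using order_tendstoD(2)[OF r0, of e] by (auto simp: eventually_sequentially)
    have "I h \<le> I (\<lambda>x. r n x + (\<Sum>i<n. g i x))"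
      by (intro I_mono h add_mem rL sL) (auto simp: r_def max_def)
    also have "\<dots> = I (r n) + (\<Sum>i<n. I (g i))"
      using g LpD by (subst I_add[OF rL sL]) (auto simp: I_sum)
    finally have "ennreal (I h) \<le> ennreal ((\<Sum>i<n. I (g i)) + e)"
      using n by (intro ennreal_leI) auto
    also have "\<dots> = (\<Sum>i<n. ennreal (I (g i))) + ennreal e"
      using \<open>0 < e\<close> I_Lp_nonneg[OF g] by (simp add: sum_ennreal sum_nonneg)
    also have "\<dots> \<le> (\<Sum>i. ennreal (I (g i))) + ennreal e"
      by (intro add_right_mono sum_le_suminf) auto
    finally show "ennreal (I h) \<le> (\<Sum>i. ennreal (I (g i))) + ennreal e" .
  qed
qed

definition majorants :: "('a \<Rightarrow> ennreal) \<Rightarrow> (nat \<Rightarrow> 'a \<Rightarrow> real) set" where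
  "majorants \<phi> = {g. (\<forall>i. g i \<in> Lp) \<and> (\<forall>x. \<phi> x \<le> (\<Sum>i. ennreal (g i x)))}"

text \<open>Modelled on Lebesgue outer measure, with nonnegative functions of the lattice in place
  of boxes. Without any majorant the infimum is over the empty set and the value is
  \<open>top\<close>.\<close>

definition upper_integral :: "('a \<Rightarrow> ennreal) \<Rightarrow> ennreal" where
  "upper_integral \<phi> = (INF g\<in>majorants \<phi>. \<Sum>i. ennreal (I (g i)))"

lemma upper_integral_le:
  "(\<And>i. g i \<in> Lp) \<Longrightarrow> (\<And>x. \<phi> x \<le> (\<Sum>i. ennreal (g i x))) \<Longrightarrow>
    upper_integral \<phi> \<le> (\<Sum>i. ennreal (I (g i)))"
  unfolding upper_integral_def by (rule INF_lower) (auto simp: majorants_def)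

lemma upper_integral_mono: "(\<And>x. \<phi> x \<le> \<psi> x) \<Longrightarrow> upper_integral \<phi> \<le> upper_integral \<psi>"
  unfolding upper_integral_def
  by (rule INF_superset_mono) (auto simp: majorants_def intro: order_trans)

lemma upper_integral_approx:
  assumes "upper_integral \<phi> \<noteq> \<infinity>" "0 < e"
  obtains g where "\<And>i. g i \<in> Lp" "\<And>x. \<phi> x \<le> (\<Sum>i. ennreal (g i x))"
    "(\<Sum>i. ennreal (I (g i))) < upper_integral \<phi> + ennreal e"
proof -
  have "\<exists>g\<in>majorants \<phi>. (\<Sum>i. ennreal (I (g i))) < upper_integral \<phi> + ennreal e"
    by (rule INF_approx_ennreal[OF assms(2) _ assms(1)]) (simp add: upper_integral_def)
  then show thesis using that by (auto simp: majorants_def)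
qed

lemma upper_integral_eq:
  assumes "h \<in> Lp"
  shows "upper_integral (\<lambda>x. ennreal (h x)) = ennreal (I h)"
proof (rule antisym)
  let ?g = "\<lambda>i::nat. if i = 0 then h else (\<lambda>x. 0)"
  have "upper_integral (\<lambda>x. ennreal (h x)) \<le> (\<Sum>i. ennreal (I (?g i)))"
  proof (rule upper_integral_le)
    show "?g i \<in> Lp" for i using assms zero_mem by (auto simp: Lp_def)
    show "ennreal (h x) \<le> (\<Sum>i. ennreal (?g i x))" for x
      using suminf_finite[of "{0}" "\<lambda>i. ennreal (?g i x)"] by auto
  qed
  also have "\<dots> = ennreal (I h)"
    using suminf_finite[of "{0}" "\<lambda>i. ennreal (I (?g i))"] by (auto simp: I_zero)
  finally show "upper_integral (\<lambda>x. ennreal (h x)) \<le> ennreal (I h)" .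
  show "ennreal (I h) \<le> upper_integral (\<lambda>x. ennreal (h x))"
    unfolding upper_integral_def using assms LpD(1)
    by (intro INF_greatest I_le_suminf) (auto simp: majorants_def)
qed

text \<open>Majorants that are optimal up to \<open>e / 2 ^ Suc i\<close> are merged into a single
  sequence along \<open>prod_decode\<close>; all terms are nonnegative, so the double series may be
  rearranged.\<close>

lemma upper_integral_suminf:
  "upper_integral (\<lambda>x. \<Sum>i. \<phi> i x) \<le> (\<Sum>i. upper_integral (\<phi> i))"
proof (rule ennreal_le_epsilon)
  fix e :: real
  assume fin: "(\<Sum>i. upper_integral (\<phi> i)) < top" and e: "0 < e"
  have "upper_integral (\<phi> i) \<noteq> \<infinity>" for i
    using ennreal_suminf_lessD[OF fin, of i] by auto
  then have "\<exists>g. (\<forall>j. g j \<in> Lp) \<and> (\<forall>x. \<phi> i x \<le> (\<Sum>j. ennreal (g j x))) \<and>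
      (\<Sum>j. ennreal (I (g j))) < upper_integral (\<phi> i) + ennreal (e * (1/2) ^ Suc i)" for i
    using upper_integral_approx[of "\<phi> i" "e * (1/2) ^ Suc i"] e by (metis mult_pos_pos half_gt_zero_iff zero_less_one zero_less_power)
  then obtain g where g: "\<And>i j. g i j \<in> Lp" "\<And>i x. \<phi> i x \<le> (\<Sum>j. ennreal (g i j x))"
      "\<And>i. (\<Sum>j. ennreal (I (g i j))) < upper_integral (\<phi> i) + ennreal (e * (1/2) ^ Suc i)"
    by metis
  let ?G = "\<lambda>k. case prod_decode k of (i, j) \<Rightarrow> g i j"
  have "upper_integral (\<lambda>x. \<Sum>i. \<phi> i x) \<le> (\<Sum>k. ennreal (I (?G k)))"
  proof (rule upper_integral_le)
    show "?G k \<in> Lp" for k using g(1) by (simp split: prod.split)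
    fix x
    have "(\<Sum>i. \<phi> i x) \<le> (\<Sum>i. \<Sum>j. ennreal (g i j x))"
      by (intro suminf_le g) auto
    also have "\<dots> = (\<Sum>k. (\<lambda>(i, j). ennreal (g i j x)) (prod_decode k))"
      by (rule suminf_ennreal_2dimen[symmetric]) simp
    also have "\<dots> = (\<Sum>k. ennreal (?G k x))"
      by (intro suminf_cong) (simp split: prod.split)
    finally show "(\<Sum>i. \<phi> i x) \<le> (\<Sum>k. ennreal (?G k x))" .
  qed
  also have "\<dots> = (\<Sum>k. (\<lambda>(i, j). ennreal (I (g i j))) (prod_decode k))"
    by (intro suminf_cong) (simp split: prod.split)
  also have "\<dots> = (\<Sum>i. \<Sum>j. ennreal (I (g i j)))"
    by (rule suminf_ennreal_2dimen) simp
  also have "\<dots> \<le> (\<Sum>i. upper_integral (\<phi> i) + ennreal (e * (1/2) ^ Suc i))"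
    by (intro suminf_le less_imp_le g) auto
  also have "\<dots> = (\<Sum>i. upper_integral (\<phi> i)) + (\<Sum>i. ennreal (e * (1/2) ^ Suc i))"
    by (intro suminf_add[symmetric]) auto
  also have "(\<Sum>i. ennreal (e * (1/2) ^ Suc i)) = ennreal e"
    using e by (intro suminf_ennreal_eq) (auto intro: sums_mult[OF power_half_series, of e, simplified])
  finally show "upper_integral (\<lambda>x. \<Sum>i. \<phi> i x) \<le> (\<Sum>i. upper_integral (\<phi> i)) + ennreal e" .
qed

lemma upper_integral_add:
  "upper_integral (\<lambda>x. \<phi> x + \<psi> x) \<le> upper_integral \<phi> + upper_integral \<psi>"
proof -
  let ?u = "\<lambda>i::nat. if i = 0 then \<phi> else if i = 1 then \<psi> else (\<lambda>x. 0)"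
  have z: "upper_integral (\<lambda>x. 0) = 0"
    using upper_integral_eq[of "\<lambda>x. 0"] zero_mem by (simp add: Lp_def I_zero)
  have "(\<Sum>i. ?u i x) = \<phi> x + \<psi> x" for x
    using suminf_finite[of "{0, 1}" "\<lambda>i. ?u i x"] by auto
  moreover have "(\<Sum>i. upper_integral (?u i)) = upper_integral \<phi> + upper_integral \<psi>"
    using suminf_finite[of "{0, 1}" "\<lambda>i. upper_integral (?u i)"] by (auto simp: z)
  ultimately show ?thesis using upper_integral_suminf[of ?u] by simp
qed

definition outer :: "'a set \<Rightarrow> ennreal" where
  "outer E = upper_integral (indicator E)"

lemma outer_mono: "E \<subseteq> F \<Longrightarrow> outer E \<le> outer F"
  unfolding outer_def by (intro upper_integral_mono) (auto simp: indicator_def)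

lemma outer_measure_space_outer: "outer_measure_space (Pow UNIV) outer"
  unfolding outer_measure_space_def positive_def increasing_def countably_subadditive_def
proof (intro conjI allI ballI impI)
  show "outer {} = 0"
    using upper_integral_eq[of "\<lambda>x. 0"] zero_mem
    by (simp add: Lp_def I_zero outer_def indicator_def[abs_def])
  fix S :: "nat \<Rightarrow> 'a set" assume "disjoint_family S"
  then have "outer (\<Union>i. S i) = upper_integral (\<lambda>x. \<Sum>i. indicator (S i) x)"
    by (simp add: outer_def suminf_indicator)
  also have "\<dots> \<le> (\<Sum>i. outer (S i))"
    unfolding outer_def by (rule upper_integral_suminf)
  finally show "outer (\<Union>i. S i) \<le> (\<Sum>i. outer (S i))" .
qed (auto intro: outer_mono)

text \<open>
  With \<open>k n = min g (n * h)\<close>, which increases to \<open>g\<close> on \<open>P\<close> and vanishes off \<open>P\<close>, the first summand is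
  at most \<open>lim I (k n)\<close> and the second one at most \<open>I g - I (k n)\<close> for every \<open>n\<close>.
\<close>

lemma upper_integral_split:
  assumes g: "g \<in> Lp" and h: "h \<in> Lp"
  defines "P \<equiv> {x. 0 < h x}"
  shows "upper_integral (\<lambda>x. ennreal (g x) * indicator P x) +
    upper_integral (\<lambda>x. ennreal (g x) * indicator (- P) x) \<le> ennreal (I g)"
proof -
  define k where "k n x = min (g x) (real n * h x)" for n x
  have g0: "0 \<le> g x" and h0: "0 \<le> h x" for x using g h LpD(2) by auto
  have kL: "k n \<in> L" for n
    unfolding k_def[abs_def] using g h LpD(1) by (intro min_mem scale_mem) auto
  have kmono: "k n x \<le> k (Suc n) x" for n x
    using h0[of x] by (auto simp: k_def min_def algebra_simps)
  have kle: "k n x \<le> g x" for n x by (simp add: k_def)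
  have k0: "k 0 = (\<lambda>x. 0)" using g0 by (auto simp: k_def min_def fun_eq_iff intro: antisym)
  have lim: "(\<lambda>n. k n x) \<longlonglongrightarrow> (if x \<in> P then g x else 0)" for x
  proof (cases "x \<in> P")
    case True
    then have hx: "0 < h x" by (simp add: P_def)
    obtain N where N: "g x / h x \<le> real N" using real_arch_simple by blast
    have "k n x = g x" if "n \<ge> N" for n
    proof -
      have "g x / h x \<le> real n" using N that by linarith
      then show ?thesis using hx by (simp add: k_def min_def field_simps)
    qed
    then have "\<forall>\<^sub>F n in sequentially. k n x = g x" by (auto simp: eventually_sequentially)
    then show ?thesis using True by (simp add: tendsto_eventually)
  next
    case False
    then have "h x = 0" using h0[of x] by (simp add: P_def)
    then show ?thesis using False g0[of x] by (simp add: k_def)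
  qed
  have dL: "(\<lambda>x. k (Suc n) x - k n x) \<in> Lp" for n
    using kmono by (intro LpI diff_mem kL) simp
  have "upper_integral (\<lambda>x. ennreal (g x) * indicator P x)
      \<le> (\<Sum>n. ennreal (I (\<lambda>x. k (Suc n) x - k n x)))"
  proof (rule upper_integral_le[OF dL])
    fix x
    have "(\<lambda>n. k (Suc n) x - k n x) sums ((if x \<in> P then g x else 0) - k 0 x)"
      by (rule telescope_sums[OF lim])
    then have "(\<Sum>n. ennreal (k (Suc n) x - k n x)) = ennreal (if x \<in> P then g x else 0)"
      using kmono by (intro suminf_ennreal_eq) (auto simp: k0)
    then show "ennreal (g x) * indicator P x \<le> (\<Sum>n. ennreal (k (Suc n) x - k n x))"
      by (auto simp: indicator_def)
  qed
  also have "(\<Sum>n. ennreal (I (\<lambda>x. k (Suc n) x - k n x))) = (\<Sum>n. ennreal (I (k (Suc n)) - I (k n)))"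
    by (simp add: I_diff kL)
  finally have 1: "upper_integral (\<lambda>x. ennreal (g x) * indicator P x)
      \<le> (\<Sum>n. ennreal (I (k (Suc n)) - I (k n)))" .
  have "(\<Sum>n. ennreal (I (k (Suc n)) - I (k n))) +
      upper_integral (\<lambda>x. ennreal (g x) * indicator (- P) x) \<le> ennreal (I g)"
  proof (rule ennreal_suminf_bound_add)
    fix m
    have Ik: "I (k n) \<le> I (k (Suc n))" for n by (intro I_mono kL kmono)
    have "(\<Sum>n<m. ennreal (I (k (Suc n)) - I (k n))) = ennreal (\<Sum>n<m. I (k (Suc n)) - I (k n))"
      using Ik by (intro sum_ennreal) simp
    also have "(\<Sum>n<m. I (k (Suc n)) - I (k n)) = I (k m)"
      using sum_lessThan_telescope[of "\<lambda>n. I (k n)" m] by (simp add: k0 I_zero)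
    finally have a: "(\<Sum>n<m. ennreal (I (k (Suc n)) - I (k n))) = ennreal (I (k m))" .
    have gk: "(\<lambda>x. g x - k m x) \<in> Lp"
      using g LpD(1) kle by (intro LpI diff_mem kL) auto
    have "upper_integral (\<lambda>x. ennreal (g x) * indicator (- P) x)
        \<le> upper_integral (\<lambda>x. ennreal (g x - k m x))"
    proof (rule upper_integral_mono)
      fix x show "ennreal (g x) * indicator (- P) x \<le> ennreal (g x - k m x)"
        using h0[of x] g0[of x] by (auto simp: indicator_def P_def k_def)
    qed
    also have "\<dots> = ennreal (I g - I (k m))"
      using upper_integral_eq[OF gk] g LpD(1) by (simp add: I_diff kL)
    finally have "(\<Sum>n<m. ennreal (I (k (Suc n)) - I (k n))) +
        upper_integral (\<lambda>x. ennreal (g x) * indicator (- P) x)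
        \<le> ennreal (I (k m)) + ennreal (I g - I (k m))"
      unfolding a by (rule add_left_mono)
    also have "\<dots> = ennreal (I g)"
    proof -
      have "0 \<le> I (k m)" using kL h0 g0 by (intro I_nonneg) (auto simp: k_def)
      moreover have "I (k m) \<le> I g" using g LpD(1) by (intro I_mono kL kle) auto
      ultimately show ?thesis by (subst ennreal_plus[symmetric]) auto
    qed
    finally show "(\<Sum>n<m. ennreal (I (k (Suc n)) - I (k n))) +
        upper_integral (\<lambda>x. ennreal (g x) * indicator (- P) x) \<le> ennreal (I g)" .
  qed
  with 1 show ?thesis by (meson add_right_mono order_trans)
qed

text \<open>A nearly optimal majorant of \<open>E\<close>, multiplied by the indicators of
  \<open>?P\<close> and of its complement, covers the two halves of \<open>E\<close>.
  \<open>upper_integral_split\<close> bounds the joint cost of the halves of each single term, so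
  the sum costs no more than the majorant did. The other inequality is subadditivity.\<close>

lemma positive_set_lambda_system:
  assumes h: "h \<in> Lp"
  shows "{x. 0 < h x} \<in> lambda_system UNIV (Pow UNIV) outer"
proof -
  let ?P = "{x. 0 < h x}"
  have "outer (E \<inter> ?P) + outer (E - ?P) = outer E" for E
  proof (rule antisym)
    show "outer E \<le> outer (E \<inter> ?P) + outer (E - ?P)"
      unfolding outer_def
      by (rule order_trans[OF upper_integral_mono upper_integral_add]) (auto simp: indicator_def)
    show "outer (E \<inter> ?P) + outer (E - ?P) \<le> outer E"
    proof (rule ennreal_le_epsilon)
      fix e :: real
      assume fin: "outer E < top" and e: "0 < e"
      obtain g where g: "\<And>i. g i \<in> Lp" "\<And>x. indicator E x \<le> (\<Sum>i. ennreal (g i x))"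
          "(\<Sum>i. ennreal (I (g i))) < outer E + ennreal e"
        using upper_integral_approx[of "indicator E" e] fin e by (auto simp: outer_def less_top)
      have *: "outer (E \<inter> Q) \<le> (\<Sum>i. upper_integral (\<lambda>x. ennreal (g i x) * indicator Q x))" for Q
        unfolding outer_def
      proof (rule order_trans[OF upper_integral_mono upper_integral_suminf])
        fix x show "indicator (E \<inter> Q) x \<le> (\<Sum>i. ennreal (g i x) * indicator Q x)"
          using g(2)[of x] by (auto simp: indicator_def)
      qed
      have "outer (E \<inter> ?P) + outer (E - ?P) \<le>
          (\<Sum>i. upper_integral (\<lambda>x. ennreal (g i x) * indicator ?P x)) +
          (\<Sum>i. upper_integral (\<lambda>x. ennreal (g i x) * indicator (- ?P) x))"
        using add_mono[OF *[of ?P] *[of "- ?P"]] by (simp add: Diff_eq)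
      also have "\<dots> = (\<Sum>i. upper_integral (\<lambda>x. ennreal (g i x) * indicator ?P x) +
          upper_integral (\<lambda>x. ennreal (g i x) * indicator (- ?P) x))"
        by (rule suminf_add) auto
      also have "\<dots> \<le> (\<Sum>i. ennreal (I (g i)))"
        by (intro suminf_le upper_integral_split g(1) h) auto
      also have "\<dots> \<le> outer E + ennreal e" using g(3) by simp
      finally show "outer (E \<inter> ?P) + outer (E - ?P) \<le> outer E + ennreal e" .
    qed
  qed
  then show ?thesis
    using algebra.lambda_system_eq[OF sigma_algebra.axioms(1)[OF sigma_algebra_Pow], of UNIV outer]
    by (auto simp: sigma_algebra.axioms)
qed

text \<open>Caratheodory's lemma on a sub-sigma-algebra. Additivity has to be supplied, because
  \<open>measure_of\<close> falls back to the null measure when its argument is not a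
  measure.\<close>

lemma emeasure_measure_of_outer:
  assumes "sigma_algebra UNIV S" "S \<subseteq> lambda_system UNIV (Pow UNIV) outer" "E \<in> S"
  shows "emeasure (measure_of UNIV S outer) E = outer E"
proof (rule emeasure_measure_of_sigma[OF assms(1) _ _ assms(3)])
  have "measure_space UNIV (lambda_system UNIV (Pow UNIV) outer) outer"
    by (rule sigma_algebra.caratheodory_lemma[OF sigma_algebra_Pow outer_measure_space_outer])
  then show "positive S outer" "countably_additive S outer"
    using assms(2) by (auto simp: measure_space_def positive_def countably_additive_def)
qed

text \<open>Slicing \<open>f\<close> into layers of height \<open>e\<close> compares both integrals
  with \<open>e\<close> times the outer measures of level sets. The comparison is off by one layer,
  so it holds up to the lowest layer \<open>min f e\<close>. That layer disappears as
  \<open>e\<close> tends to 0: by monotone convergence for the measure, by Daniell continuity for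
  \<open>I\<close>.\<close>

lemma nn_integral_eq_I:
  assumes M: "\<And>E. E \<in> sets M \<Longrightarrow> emeasure M E = outer E" "space M = UNIV"
    and f: "f \<in> Lp" "f \<in> borel_measurable M"
  shows "(\<integral>\<^sup>+x. ennreal (f x) \<partial>M) = ennreal (I f)"
proof -
  have f0: "0 \<le> f x" for x using f(1) LpD(2) by auto
  have fL: "f \<in> L" using f(1) LpD(1) by auto
  define t where "t c x = f x - min (f x) c" for c x
  obtain B where B: "\<And>x. f x \<le> B" using bounded_above[OF fL] by auto
  have *: "(\<integral>\<^sup>+x. ennreal (t e x) \<partial>M) \<le> ennreal (I f) \<and>
           ennreal (I (t e)) \<le> (\<integral>\<^sup>+x. ennreal (f x) \<partial>M)" if e: "0 < e" for e :: real
  proof -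
    \<comment> \<open>Horizontal layers of \<open>f\<close> of height \<open>e\<close>; the level sets \<open>P i\<close> satisfy \<open>s (Suc i) \<le> e 1\<^sub>P \<le> s i\<close>.\<close>
    define s where "s i x = min (f x) (real (Suc i) * e) - min (f x) (real i * e)" for i x
    have sm: "min (f x) (real i * e) \<le> min (f x) (real (Suc i) * e)" for i x
      using e by (auto simp: min_def algebra_simps)
    have sL: "s i \<in> Lp" for i
    \<comment> \<open>\<open>min_const_mem\<close> asks for a positive height, so the bottom layer
      is rewritten as \<open>min f e\<close>.\<close>
    proof (cases "i = 0")
      case True
      then have "s i = (\<lambda>x. min (f x) e)" using f0 by (auto simp: s_def min_def fun_eq_iff intro: antisym)
      then show ?thesis using f0 e fL by (auto intro!: LpI min_const_mem)
    next
      case False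
      then show ?thesis unfolding s_def[abs_def]
        using sm e by (intro LpI diff_mem min_const_mem fL) auto
    qed
    have sM: "s i \<in> borel_measurable M" for i
      unfolding s_def[abs_def] using f(2) by measurable
    define P where "P i = {x. real (Suc i) * e < f x}" for i
    have PM: "P i \<in> sets M" for i
    proof -
      have "{x\<in>space M. real (Suc i) * e < f x} \<in> sets M" using f(2) by measurable
      then show ?thesis using M(2) by (simp add: P_def)
    qed
    have up: "s (Suc i) x \<le> e * indicator (P i) x" for i x
      using e by (auto simp: s_def P_def indicator_def min_def algebra_simps)
    have dn: "e * indicator (P i) x \<le> s i x" for i x
      using e f0[of x] by (auto simp: s_def P_def indicator_def min_def algebra_simps)
    have cm: "(\<integral>\<^sup>+x. ennreal (e * indicator (P i) x) \<partial>M) = ennreal e * outer (P i)" for i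
      using nn_integral_cmult_indicator[OF PM[of i], of "ennreal e"] e M(1)[OF PM[of i]]
      by (simp add: ennreal_mult' ennreal_indicator)
    \<comment> \<open>Since \<open>f\<close> is bounded, \<open>N\<close> layers reach its top, and
      the layers shifted by one telescope exactly to \<open>t e\<close>.\<close>
    obtain N where N: "B \<le> real N * e" using real_arch_simple[of "B / e"] e by (auto simp: field_simps)
    have sumS: "(\<Sum>i<n. s i x) = min (f x) (real n * e)" for n :: nat and x
      unfolding s_def using f0[of x] by (subst sum_lessThan_telescope) simp
    have sumS': "(\<Sum>i<N. s (Suc i) x) = t e x" for x
    proof -
      have "f x \<le> real (Suc N) * e" using N B[of x] e by (simp add: algebra_simps)
      then show ?thesis
        using sum_lessThan_telescope[of "\<lambda>i. min (f x) (real (Suc i) * e)" N]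
        by (simp add: s_def t_def del: of_nat_Suc)
    qed
    have lower: "ennreal (I (s (Suc i))) \<le> ennreal e * outer (P i)" for i
    proof -
      have "(\<lambda>x. inverse e * s (Suc i) x) \<in> Lp"
        using sL[of "Suc i"] e by (auto simp: Lp_def intro: scale_mem)
      then have "ennreal (inverse e * I (s (Suc i))) = upper_integral (\<lambda>x. ennreal (inverse e * s (Suc i) x))"
        using sL[of "Suc i"] by (simp add: upper_integral_eq I_scale LpD(1))
      also have "\<dots> \<le> outer (P i)"
        unfolding outer_def
      proof (rule upper_integral_mono)
        fix x
        have "inverse e * s (Suc i) x \<le> indicator (P i) x"
          using up[of i x] e by (simp add: field_simps)
        then show "ennreal (inverse e * s (Suc i) x) \<le> indicator (P i) x"
          by (metis ennreal_indicator ennreal_leI)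
      qed
      finally have "ennreal e * ennreal (inverse e * I (s (Suc i))) \<le> ennreal e * outer (P i)"
        by (rule mult_left_mono) simp
      then show ?thesis using e by (simp add: ennreal_mult'[symmetric] mult.assoc[symmetric])
    qed
    have upper: "ennreal e * outer (P i) \<le> ennreal (I (s i))" for i
    proof -
      have sc: "(\<lambda>x. inverse e * s i x) \<in> Lp"
        using sL[of i] e by (auto simp: Lp_def intro: scale_mem)
      have "outer (P i) \<le> upper_integral (\<lambda>x. ennreal (inverse e * s i x))"
        unfolding outer_def
      proof (rule upper_integral_mono)
        fix x
        have "indicator (P i) x \<le> inverse e * s i x"
          using dn[of i x] e by (simp add: field_simps)
        then show "indicator (P i) x \<le> ennreal (inverse e * s i x)"
          by (metis ennreal_indicator ennreal_leI)
      qed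
      also have "\<dots> = ennreal (inverse e * I (s i))"
        using sL[of i] by (simp add: upper_integral_eq[OF sc] I_scale LpD(1))
      finally have "ennreal e * outer (P i) \<le> ennreal e * ennreal (inverse e * I (s i))"
        by (rule mult_left_mono) simp
      then show ?thesis using e by (simp add: ennreal_mult'[symmetric] mult.assoc[symmetric])
    qed
    have s0: "0 \<le> s i x" for i x using sL LpD(2) by blast
    have intsum: "(\<integral>\<^sup>+x. ennreal (\<Sum>i<n. s (k i) x) \<partial>M) = (\<Sum>i<n. \<integral>\<^sup>+x. ennreal (s (k i) x) \<partial>M)"
      for n :: nat and k :: "nat \<Rightarrow> nat"
    proof -
      have "(\<integral>\<^sup>+x. ennreal (\<Sum>i<n. s (k i) x) \<partial>M) = (\<integral>\<^sup>+x. (\<Sum>i<n. ennreal (s (k i) x)) \<partial>M)"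
        using s0 by (simp add: sum_ennreal)
      also have "\<dots> = (\<Sum>i<n. \<integral>\<^sup>+x. ennreal (s (k i) x) \<partial>M)"
        using sM by (intro nn_integral_sum) measurable
      finally show ?thesis .
    qed
    have Isum: "ennreal (I (\<lambda>x. \<Sum>i<n. s (k i) x)) = (\<Sum>i<n. ennreal (I (s (k i))))"
      for n :: nat and k :: "nat \<Rightarrow> nat"
      using sL by (subst I_sum) (auto simp: sum_ennreal I_Lp_nonneg LpD(1))
    have bd: "(\<Sum>i<N. s i x) \<le> f x" for x by (simp add: sumS)
    show ?thesis
    proof
      have "(\<integral>\<^sup>+x. ennreal (t e x) \<partial>M) = (\<Sum>i<N. \<integral>\<^sup>+x. ennreal (s (Suc i) x) \<partial>M)"
        by (simp add: sumS'[symmetric] intsum)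
      also have "\<dots> \<le> (\<Sum>i<N. ennreal e * outer (P i))"
        unfolding cm[symmetric] using up by (intro sum_mono nn_integral_mono ennreal_leI) auto
      also have "\<dots> \<le> (\<Sum>i<N. ennreal (I (s i)))" by (intro sum_mono upper)
      also have "\<dots> = ennreal (I (\<lambda>x. \<Sum>i<N. s i x))" by (simp add: Isum)
      also have "\<dots> \<le> ennreal (I f)"
        using sL by (intro ennreal_leI I_mono sum_mem fL bd LpD(1))
      finally show "(\<integral>\<^sup>+x. ennreal (t e x) \<partial>M) \<le> ennreal (I f)" .
      have "ennreal (I (t e)) = (\<Sum>i<N. ennreal (I (s (Suc i))))"
        unfolding Isum[of Suc N, symmetric] sumS' ..
      also have "\<dots> \<le> (\<Sum>i<N. ennreal e * outer (P i))" by (intro sum_mono lower)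
      also have "\<dots> \<le> (\<Sum>i<N. \<integral>\<^sup>+x. ennreal (s i x) \<partial>M)"
        unfolding cm[symmetric] using dn by (intro sum_mono nn_integral_mono ennreal_leI) auto
      also have "\<dots> = (\<integral>\<^sup>+x. ennreal (\<Sum>i<N. s i x) \<partial>M)" by (simp add: intsum)
      also have "\<dots> \<le> (\<integral>\<^sup>+x. ennreal (f x) \<partial>M)"
        by (intro nn_integral_mono ennreal_leI bd)
      finally show "ennreal (I (t e)) \<le> (\<integral>\<^sup>+x. ennreal (f x) \<partial>M)" .
    qed
  qed
  \<comment> \<open>Layer heights that decrease to 0, so that \<open>t (c n)\<close> increases to
    \<open>f\<close>.\<close>
  define c where "c n = inverse (real (Suc n))" for n
  have c0: "0 < c n" for n by (simp add: c_def)
  have cmono: "c (Suc n) \<le> c n" for n by (simp add: c_def)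
  have clim: "c \<longlonglongrightarrow> 0" unfolding c_def using LIMSEQ_inverse_real_of_nat by simp
  have mlim: "(\<lambda>n. min (f x) (c n)) \<longlonglongrightarrow> 0" for x
  proof -
    have "(\<lambda>n. min (f x) (c n)) \<longlonglongrightarrow> min (f x) 0" by (intro tendsto_intros clim)
    then show ?thesis using f0[of x] by simp
  qed
  have tM: "t e \<in> borel_measurable M" for e
    unfolding t_def[abs_def] using f(2) by measurable
  show ?thesis
  proof (rule antisym)
    have tinc: "incseq (\<lambda>n x. ennreal (t (c n) x))"
      using cmono by (intro incseq_SucI le_funI ennreal_leI) (auto simp: t_def min_def, meson cmono order_trans)
    have sup: "(SUP n. ennreal (t (c n) x)) = ennreal (f x)" for x
    proof (rule LIMSEQ_unique[OF LIMSEQ_SUP])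
      show "incseq (\<lambda>n. ennreal (t (c n) x))" using tinc by (auto simp: incseq_def le_fun_def)
      have "(\<lambda>n. f x - min (f x) (c n)) \<longlonglongrightarrow> f x - 0" by (intro tendsto_intros mlim)
      then show "(\<lambda>n. ennreal (t (c n) x)) \<longlonglongrightarrow> ennreal (f x)"
        by (auto simp: t_def intro: tendsto_ennrealI)
    qed
    have "(\<integral>\<^sup>+x. ennreal (f x) \<partial>M) = (SUP n. \<integral>\<^sup>+x. ennreal (t (c n) x) \<partial>M)"
      unfolding sup[symmetric] using tM by (intro nn_integral_monotone_convergence_SUP tinc) auto
    also have "\<dots> \<le> ennreal (I f)" using * c0 by (intro SUP_least) auto
    finally show "(\<integral>\<^sup>+x. ennreal (f x) \<partial>M) \<le> ennreal (I f)" .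
    have "(\<lambda>n. I (\<lambda>x. min (f x) (c n))) \<longlonglongrightarrow> 0"
      using mlim cmono c0 by (intro I_decseq min_const_mem fL decseq_SucI) (auto simp: min_le_iff_disj)
    then have "(\<lambda>n. I f - I (\<lambda>x. min (f x) (c n))) \<longlonglongrightarrow> I f - 0"
      by (intro tendsto_intros)
    moreover have "I (t (c n)) = I f - I (\<lambda>x. min (f x) (c n))" for n
      unfolding t_def[abs_def] by (intro I_diff fL min_const_mem c0)
    ultimately have "(\<lambda>n. ennreal (I (t (c n)))) \<longlonglongrightarrow> ennreal (I f)"
      by (intro tendsto_ennrealI) simp
    then show "ennreal (I f) \<le> (\<integral>\<^sup>+x. ennreal (f x) \<partial>M)"
      by (rule LIMSEQ_le_const2) (use * c0 in auto)
  qed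
qed

end

section \<open>The positive part of an order bounded functional\<close>

locale order_bounded_form = function_lattice L for L :: "('a \<Rightarrow> real) set" +
  fixes T :: "('a \<Rightarrow> real) \<Rightarrow> real"
  assumes T_add: "f \<in> L \<Longrightarrow> g \<in> L \<Longrightarrow> T (\<lambda>x. f x + g x) = T f + T g"
    and T_scale: "f \<in> L \<Longrightarrow> T (\<lambda>x. c * f x) = c * T f"
    and T_bdd: "f \<in> L \<Longrightarrow> bdd_above (T ` {g \<in> L. \<forall>x. 0 \<le> g x \<and> g x \<le> f x})"
begin

lemma T_diff: "f \<in> L \<Longrightarrow> g \<in> L \<Longrightarrow> T (\<lambda>x. f x - g x) = T f - T g"
  using T_add[OF _ uminus_mem, of f g] T_scale[of g "-1"] by simp

lemma T_zero: "T (\<lambda>x. 0) = 0"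
  using T_scale[OF zero_mem, of 0] by simp

definition below :: "('a \<Rightarrow> real) \<Rightarrow> ('a \<Rightarrow> real) set" where
  "below f = {g \<in> L. \<forall>x. 0 \<le> g x \<and> g x \<le> f x}"

text \<open>Meaningful on nonnegative \<open>f\<close> only: otherwise \<open>below f\<close> is
  empty and \<open>Sup\<close> is unspecified. For this reason \<open>pos\<close> passes to the
  positive and negative parts of its argument.\<close>

definition pos_sup :: "('a \<Rightarrow> real) \<Rightarrow> real" where
  "pos_sup f = Sup (T ` below f)"

lemma belowD: "g \<in> below f \<Longrightarrow> g \<in> L" "g \<in> below f \<Longrightarrow> 0 \<le> g x" "g \<in> below f \<Longrightarrow> g x \<le> f x"
  by (auto simp: below_def)

lemma belowI: "g \<in> L \<Longrightarrow> (\<And>x. 0 \<le> g x) \<Longrightarrow> (\<And>x. g x \<le> f x) \<Longrightarrow> g \<in> below f"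
  by (auto simp: below_def)

lemma pos_sup_upper: "f \<in> L \<Longrightarrow> g \<in> below f \<Longrightarrow> T g \<le> pos_sup f"
  unfolding pos_sup_def using T_bdd[of f] by (intro cSup_upper) (auto simp: below_def)

lemma pos_sup_least:
  assumes "\<And>x. 0 \<le> f x" and "\<And>g. g \<in> below f \<Longrightarrow> T g \<le> c"
  shows "pos_sup f \<le> c"
proof -
  have "(\<lambda>x. 0) \<in> below f" using assms(1) zero_mem by (auto simp: below_def)
  then show ?thesis unfolding pos_sup_def using assms(2) by (intro cSup_least) auto
qed

lemma pos_sup_add:
  assumes f: "f \<in> L" "\<And>x. 0 \<le> f x" and g: "g \<in> L" "\<And>x. 0 \<le> g x"
  shows "pos_sup (\<lambda>x. f x + g x) = pos_sup f + pos_sup g"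
proof (rule antisym)
  show "pos_sup (\<lambda>x. f x + g x) \<le> pos_sup f + pos_sup g"
  proof (rule pos_sup_least)
    fix h assume h: "h \<in> below (\<lambda>x. f x + g x)"
    \<comment> \<open>Riesz decomposition: \<open>h = min h f + (h - min h f)\<close> with \<open>h - min h f \<le> g\<close>.\<close>
    let ?m = "\<lambda>x. min (h x) (f x)"
    have m: "?m \<in> L" using h f belowD(1) by (intro min_mem) auto
    have "?m \<in> below f" using m f(2) belowD(2)[OF h] by (intro belowI) auto
    moreover have "(\<lambda>x. h x - ?m x) \<in> below g"
      using diff_mem[OF belowD(1)[OF h] m] g(2) belowD(3)[OF h]
      by (intro belowI) (auto simp: min_def algebra_simps)
    ultimately have "T ?m + T (\<lambda>x. h x - ?m x) \<le> pos_sup f + pos_sup g"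
      using f g by (intro add_mono pos_sup_upper)
    then show "T h \<le> pos_sup f + pos_sup g"
      using T_diff[OF belowD(1)[OF h] m] by simp
  qed (use f g in auto)
  \<comment> \<open>The two suprema are taken in turn: \<open>u\<close> is held fixed while
    \<open>v\<close> runs through \<open>below g\<close>.\<close>
  have "pos_sup f \<le> pos_sup (\<lambda>x. f x + g x) - pos_sup g"
  proof (rule pos_sup_least[OF f(2)])
    fix u assume u: "u \<in> below f"
    have "pos_sup g \<le> pos_sup (\<lambda>x. f x + g x) - T u"
    proof (rule pos_sup_least[OF g(2)])
      fix v assume v: "v \<in> below g"
      have "(\<lambda>x. u x + v x) \<in> below (\<lambda>x. f x + g x)"
        using belowD[OF u] belowD[OF v] by (intro belowI add_mem add_nonneg_nonneg add_mono)
      then have "T (\<lambda>x. u x + v x) \<le> pos_sup (\<lambda>x. f x + g x)"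
        using f g by (intro pos_sup_upper add_mem)
      then show "T v \<le> pos_sup (\<lambda>x. f x + g x) - T u"
        using T_add[OF belowD(1)[OF u] belowD(1)[OF v]] by simp
    qed
    then show "T u \<le> pos_sup (\<lambda>x. f x + g x) - pos_sup g" by simp
  qed
  then show "pos_sup f + pos_sup g \<le> pos_sup (\<lambda>x. f x + g x)" by simp
qed

lemma pos_sup_scale_le:
  assumes f: "f \<in> L" "\<And>x. 0 \<le> f x" and c: "0 < c"
  shows "pos_sup (\<lambda>x. c * f x) \<le> c * pos_sup f"
proof (rule pos_sup_least)
  fix h assume h: "h \<in> below (\<lambda>x. c * f x)"
  have "(\<lambda>x. inverse c * h x) \<in> below f"
    using belowD[OF h] c by (intro belowI scale_mem) (auto simp: field_simps)
  then have "inverse c * T h \<le> pos_sup f"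
    using pos_sup_upper[OF f(1)] T_scale[OF belowD(1)[OF h], of "inverse c"] by metis
  then show "T h \<le> c * pos_sup f" using c by (simp add: field_simps)
qed (use f c in auto)

lemma pos_sup_zero: "pos_sup (\<lambda>x. 0) = 0"
  using pos_sup_add[of "\<lambda>x. 0" "\<lambda>x. 0"] zero_mem by simp

lemma pos_sup_scale:
  assumes f: "f \<in> L" "\<And>x. 0 \<le> f x" and c: "0 \<le> c"
  shows "pos_sup (\<lambda>x. c * f x) = c * pos_sup f"
proof (cases "c = 0")
  case False
  then have c: "0 < c" using c by simp
  \<comment> \<open>The reverse inequality is the one already shown, for the factor
    \<open>inverse c\<close> and the function \<open>c * f\<close>.\<close>
  have "pos_sup (\<lambda>x. inverse c * (c * f x)) \<le> inverse c * pos_sup (\<lambda>x. c * f x)"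
    using f c by (intro pos_sup_scale_le scale_mem) auto
  then have "c * pos_sup f \<le> pos_sup (\<lambda>x. c * f x)"
    using c by (simp add: field_simps)
  then show ?thesis using pos_sup_scale_le[OF f c] by simp
qed (simp add: pos_sup_zero)

definition pos :: "('a \<Rightarrow> real) \<Rightarrow> real" where
  "pos f = pos_sup (\<lambda>x. max (f x) 0) - pos_sup (\<lambda>x. max (- f x) 0)"

text \<open>Adding crosswise turns two representations of \<open>f\<close> as a difference into one
  identity between sums of nonnegative functions, where \<open>pos_sup\<close> is additive.
  Linearity of \<open>pos\<close> then only needs a convenient choice of \<open>u\<close> and
  \<open>v\<close>.\<close>

lemma pos_diff_eq:
  assumes u: "u \<in> L" "\<And>x. 0 \<le> u x" and v: "v \<in> L" "\<And>x. 0 \<le> v x"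
    and f: "f \<in> L" "\<And>x. f x = u x - v x"
  shows "pos f = pos_sup u - pos_sup v"
proof -
  let ?p = "\<lambda>x. max (f x) 0" and ?n = "\<lambda>x. max (- f x) 0"
  have L: "?p \<in> L" "?n \<in> L" using f(1) by (auto intro!: max_mem zero_mem uminus_mem)
  have "(\<lambda>x. ?p x + v x) = (\<lambda>x. u x + ?n x)" using f(2) by (auto simp: max_def)
  then have "pos_sup (\<lambda>x. ?p x + v x) = pos_sup (\<lambda>x. u x + ?n x)" by simp
  moreover have "pos_sup (\<lambda>x. ?p x + v x) = pos_sup ?p + pos_sup v"
    using L v by (intro pos_sup_add) auto
  moreover have "pos_sup (\<lambda>x. u x + ?n x) = pos_sup u + pos_sup ?n"
    using L u by (intro pos_sup_add) auto
  ultimately show ?thesis by (simp add: pos_def)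
qed

lemma pos_eq: "f \<in> L \<Longrightarrow> (\<And>x. 0 \<le> f x) \<Longrightarrow> pos f = pos_sup f"
  using pos_diff_eq[of f "\<lambda>x. 0" f] zero_mem by (simp add: pos_sup_zero)

lemma parts_mem: "f \<in> L \<Longrightarrow> (\<lambda>x. max (f x) 0) \<in> L" "f \<in> L \<Longrightarrow> (\<lambda>x. max (- f x) 0) \<in> L"
  by (auto intro!: max_mem zero_mem uminus_mem)

lemma pos_add:
  assumes "f \<in> L" "g \<in> L"
  shows "pos (\<lambda>x. f x + g x) = pos f + pos g"
proof -
  have "pos (\<lambda>x. f x + g x) = pos_sup (\<lambda>x. max (f x) 0 + max (g x) 0) -
      pos_sup (\<lambda>x. max (- f x) 0 + max (- g x) 0)"
    using assms by (intro pos_diff_eq add_mem parts_mem) (auto simp: max_def)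
  then show ?thesis using assms by (simp add: pos_sup_add parts_mem pos_def)
qed

lemma pos_scale:
  assumes "f \<in> L"
  shows "pos (\<lambda>x. c * f x) = c * pos f"
proof (cases "0 \<le> c")
  case True
  have "pos (\<lambda>x. c * f x) = pos_sup (\<lambda>x. c * max (f x) 0) - pos_sup (\<lambda>x. c * max (- f x) 0)"
    using assms True by (intro pos_diff_eq scale_mem parts_mem) (auto simp: max_def)
  then show ?thesis using assms True by (simp add: pos_sup_scale parts_mem pos_def algebra_simps)
next
  case False
  have "pos (\<lambda>x. c * f x) = pos_sup (\<lambda>x. (- c) * max (- f x) 0) - pos_sup (\<lambda>x. (- c) * max (f x) 0)"
    using assms False by (intro pos_diff_eq scale_mem parts_mem) (auto simp: max_def mult_nonpos_nonneg)
  also have "\<dots> = (- c) * pos_sup (\<lambda>x. max (- f x) 0) - (- c) * pos_sup (\<lambda>x. max (f x) 0)"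
    using assms False by (simp only: pos_sup_scale parts_mem max.cobounded2 not_le neg_0_le_iff_le less_imp_le)
  finally show ?thesis by (simp add: pos_def algebra_simps)
qed

lemma pos_ge: "f \<in> L \<Longrightarrow> (\<And>x. 0 \<le> f x) \<Longrightarrow> T f \<le> pos f"
  using pos_sup_upper[of f f] by (simp add: pos_eq belowI)

lemma pos_nonneg: "f \<in> L \<Longrightarrow> (\<And>x. 0 \<le> f x) \<Longrightarrow> 0 \<le> pos f"
  using pos_sup_upper[of f "\<lambda>x. 0"] by (simp add: pos_eq belowI zero_mem T_zero)

lemma pos_diff: "f \<in> L \<Longrightarrow> g \<in> L \<Longrightarrow> pos (\<lambda>x. f x - g x) = pos f - pos g"
  using pos_add[OF _ uminus_mem, of f g] pos_scale[of g "-1"] by simp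

lemma pos_sup_approx:
  assumes "f \<in> L" "\<And>x. 0 \<le> f x" "0 < e"
  obtains y where "y \<in> below f" "pos_sup f - e < T y"
proof -
  have "\<exists>y\<in>below f. pos_sup f - e < T y"
  proof (rule ccontr)
    assume "\<not> ?thesis"
    then have "T g \<le> pos_sup f - e" if "g \<in> below f" for g using that by (simp add: not_less)
    then have "pos_sup f \<le> pos_sup f - e" by (intro pos_sup_least assms(2))
    then show False using assms(3) by simp
  qed
  then show thesis using that by auto
qed

text \<open>One near-maximizer \<open>y\<close> for \<open>u 0\<close> serves all \<open>n\<close>,
  so continuity of \<open>T\<close> is applied to the single sequence \<open>min y (u n)\<close> and
  not to maximizers that vary with \<open>n\<close>.\<close>

lemma pos_decseq:
  assumes cont: "\<And>u. (\<And>n. u n \<in> L) \<Longrightarrow> (\<And>x. decseq (\<lambda>n. u n x)) \<Longrightarrow>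
      (\<And>x. (\<lambda>n. u n x) \<longlonglongrightarrow> 0) \<Longrightarrow> (\<lambda>n. T (u n)) \<longlonglongrightarrow> 0"
    and u: "\<And>n. u n \<in> L" "\<And>x. decseq (\<lambda>n. u n x)" "\<And>x. (\<lambda>n. u n x) \<longlonglongrightarrow> 0"
  shows "(\<lambda>n. pos (u n)) \<longlonglongrightarrow> 0"
proof (rule order_tendstoI)
  have u0: "0 \<le> u n x" for n x using decseq_ge[OF u(2) u(3)] .
  fix e :: real
  show "e < 0 \<Longrightarrow> \<forall>\<^sub>F n in sequentially. e < pos (u n)"
    using pos_nonneg[OF u(1) u0] by (auto intro!: always_eventually intro: less_le_trans)
  assume e: "0 < e"
  obtain y where y: "y \<in> below (u 0)" "pos_sup (u 0) - e / 2 < T y"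
    using pos_sup_approx[OF u(1) u0, of "e / 2" 0] e by auto
  \<comment> \<open>\<open>y - min y (u n) \<le> u 0 - u n\<close> bounds \<open>pos (u n)\<close> by \<open>pos (u 0) - T y + T (min y (u n))\<close>.\<close>
  define w where "w n x = min (y x) (u n x)" for n x
  have wL: "w n \<in> L" for n unfolding w_def[abs_def] using belowD(1)[OF y(1)] u(1) by (rule min_mem)
  have "(\<lambda>n. T (w n)) \<longlonglongrightarrow> 0"
  proof (rule cont[OF wL])
    fix x
    show "decseq (\<lambda>n. w n x)"
      using u(2)[of x] by (auto simp: w_def decseq_def min_le_iff_disj)
    have "(\<lambda>n. min (y x) (u n x)) \<longlonglongrightarrow> min (y x) 0" by (intro tendsto_intros u(3))
    then show "(\<lambda>n. w n x) \<longlonglongrightarrow> 0" using belowD(2)[OF y(1)] by (simp add: w_def)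
  qed
  then have ev: "\<forall>\<^sub>F n in sequentially. T (w n) < e / 2" using e by (intro order_tendstoD) auto
  have le: "pos (u n) \<le> pos (u 0) - T y + T (w n)" for n
  proof -
    have un: "u n x \<le> u 0 x" for x using u(2)[of x] by (simp add: decseq_def)
    have d: "(\<lambda>x. u 0 x - u n x) \<in> L" by (intro diff_mem u)
    have "y x - w n x \<le> u 0 x - u n x" for x
      using belowD(3)[OF y(1), of x] un[of x] by (auto simp: w_def min_def)
    then have "(\<lambda>x. y x - w n x) \<in> below (\<lambda>x. u 0 x - u n x)"
      by (intro belowI diff_mem belowD(1)[OF y(1)] wL) (auto simp: w_def)
    then have "T (\<lambda>x. y x - w n x) \<le> pos (\<lambda>x. u 0 x - u n x)"
      using pos_sup_upper[OF d] pos_eq[OF d] un by simp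
    then show ?thesis
      using T_diff[OF belowD(1)[OF y(1)] wL[of n]] pos_diff[OF u(1) u(1), of 0 n] by simp
  qed
  show "\<forall>\<^sub>F n in sequentially. pos (u n) < e"
    using ev
  proof eventually_elim
    case (elim n)
    then show ?case using le[of n] y(2) pos_eq[OF u(1) u0, of 0] by simp
  qed
qed

end

section \<open>Compactly supported Lipschitz functions as a function lattice\<close>

lemma lipschitz_on_max:
  fixes f g :: "'a::metric_space \<Rightarrow> real"
  assumes "C-lipschitz_on U f" "D-lipschitz_on U g"
  shows "(max C D)-lipschitz_on U (\<lambda>x. max (f x) (g x))"
proof (rule lipschitz_onI)
  fix x y assume "x \<in> U" "y \<in> U"
  then have "dist (f x) (f y) \<le> C * dist x y" "dist (g x) (g y) \<le> D * dist x y"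
    using assms by (auto dest: lipschitz_onD)
  moreover have "C * dist x y \<le> max C D * dist x y" "D * dist x y \<le> max C D * dist x y"
    by (intro mult_right_mono; simp)+
  ultimately show "dist (max (f x) (g x)) (max (f y) (g y)) \<le> max C D * dist x y"
    by (auto simp: dist_real_def)
qed (use assms in \<open>auto dest: lipschitz_on_nonneg simp: le_max_iff_disj\<close>)

lemma lipschitz_on_min:
  fixes f g :: "'a::metric_space \<Rightarrow> real"
  assumes "C-lipschitz_on U f" "D-lipschitz_on U g"
  shows "(max C D)-lipschitz_on U (\<lambda>x. min (f x) (g x))"
proof -
  have "(\<lambda>x. min (f x) (g x)) = (\<lambda>x. - max (- f x) (- g x))" by (auto simp: max_def)
  then show ?thesis
    using lipschitz_on_minus[OF lipschitz_on_max[OF lipschitz_on_minus[OF assms(1)] lipschitz_on_minus[OF assms(2)]]]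
    by metis
qed

lemma lipschitz_on_infdist: "1-lipschitz_on U (\<lambda>x. infdist x A)"
  by (rule lipschitz_onI) (auto simp: dist_real_def infdist_triangle_abs)

lemma lipschitz_on_dist: "1-lipschitz_on U (\<lambda>x. dist x a)"
  using lipschitz_on_infdist[of U "{a}"] by simp

lemma compact_closure_subset:
  fixes S T :: "'a::metric_space set"
  assumes "compact (closure T)" "S \<subseteq> T"
  shows "compact (closure S)"
  using compact_Int_closed[OF assms(1) closed_closure[of S]] closure_mono[OF assms(2)]
  by (simp add: Int_absorb1)

lemma LipcI:
  assumes "C-lipschitz_on UNIV f" "compact K" "{x. f x \<noteq> 0} \<subseteq> K" "\<And>x. x \<in> A \<Longrightarrow> f x = 0"
  shows "f \<in> Lipc A"
  using assms compact_closure_subset[of K "{x. f x \<noteq> 0}"] compact_imp_closed[OF assms(2)]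
  by (auto simp: Lipc_def closure_closed)

lemma LipcE:
  assumes "f \<in> Lipc A"
  obtains C where "C-lipschitz_on UNIV f" "0 \<le> C"
  using assms by (auto simp: Lipc_def dest: lipschitz_on_nonneg)

lemma Lipc_zero: "f \<in> Lipc A \<Longrightarrow> x \<in> A \<Longrightarrow> f x = 0"
  by (auto simp: Lipc_def)

lemma Lipc_continuous: "f \<in> Lipc A \<Longrightarrow> continuous_on UNIV f"
  by (auto elim!: LipcE intro: lipschitz_on_continuous_on)

lemma Lipc_measurable: "f \<in> Lipc A \<Longrightarrow> f \<in> borel_measurable borel"
  by (intro borel_measurable_continuous_onI Lipc_continuous)

lemma compact_closure_Un:
  assumes "compact (closure S)" "compact (closure T)"
  shows "compact (closure (S \<union> T))"
  using assms by (simp add: compact_Un)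

lemma function_lattice_Lipc: "function_lattice (Lipc A)"
proof
  \<comment> \<open>A single support argument for all operations: a pointwise operation that fixes 0
    creates no support outside the union of the given ones.\<close>
  have supp: "compact (closure {x. k (f x) (g x) \<noteq> 0})"
    if "f \<in> Lipc A" "g \<in> Lipc A" "k 0 0 = 0" for f g :: "'a \<Rightarrow> real" and k :: "real \<Rightarrow> real \<Rightarrow> real"
  proof (rule compact_closure_subset)
    show "compact (closure ({x. f x \<noteq> 0} \<union> {x. g x \<noteq> 0}))"
      using that by (intro compact_closure_Un) (auto simp: Lipc_def)
    show "{x. k (f x) (g x) \<noteq> 0} \<subseteq> {x. f x \<noteq> 0} \<union> {x. g x \<noteq> 0}" using that(3) by auto
  qed
  show "(\<lambda>x. 0) \<in> Lipc A"
    using lipschitz_on_constant by (intro LipcI[of 0 _ "{}"]) auto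
  fix f g :: "'a \<Rightarrow> real" and c :: real
  assume f: "f \<in> Lipc A"
  obtain C where C: "C-lipschitz_on UNIV f" using f by (rule LipcE)
  show "(\<lambda>x. c * f x) \<in> Lipc A"
    using lipschitz_on_cmult_real[OF C, of c] supp[OF f f, of "\<lambda>u v. c * u"] f by (auto simp: Lipc_def)
  assume g: "g \<in> Lipc A"
  obtain D where D: "D-lipschitz_on UNIV g" using g by (rule LipcE)
  show "(\<lambda>x. f x + g x) \<in> Lipc A"
    using lipschitz_on_add[OF C D] supp[OF f g, of "\<lambda>u v. u + v"] f g by (auto simp: Lipc_def)
  show "(\<lambda>x. min (f x) (g x)) \<in> Lipc A"
    using lipschitz_on_min[OF C D] supp[OF f g, of min] f g by (auto simp: Lipc_def)
qed

lemma Lipc_min_one: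
  assumes "f \<in> Lipc A"
  shows "(\<lambda>x. min (f x) 1) \<in> Lipc A"
proof -
  obtain C where C: "C-lipschitz_on UNIV f" using assms by (rule LipcE)
  show ?thesis
  proof (rule LipcI[OF lipschitz_on_min[OF C lipschitz_on_constant]])
    show "compact (closure {x. f x \<noteq> 0})" using assms by (simp add: Lipc_def)
    show "{x. min (f x) 1 \<noteq> 0} \<subseteq> closure {x. f x \<noteq> 0}"
      by (rule subset_trans[OF _ closure_subset]) auto
  qed (use assms in \<open>auto simp: Lipc_def\<close>)
qed

lemma Lipc_bounded:
  assumes "f \<in> Lipc A"
  shows "\<exists>B. \<forall>x. f x \<le> B"
proof -
  let ?K = "closure {x. f x \<noteq> 0}"
  have "compact (f ` ?K)"
    using assms by (intro compact_continuous_image continuous_on_subset[OF Lipc_continuous])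
      (auto simp: Lipc_def)
  then obtain B where B: "\<And>x. x \<in> ?K \<Longrightarrow> \<bar>f x\<bar> \<le> B"
    using compact_imp_bounded[of "f ` ?K"] by (auto simp: bounded_iff)
  have "f x \<le> max B 0" for x
    using B[of x] closure_subset[of "{x. f x \<noteq> 0}"] by (cases "f x = 0") (auto simp: le_max_iff_disj)
  then show ?thesis by blast
qed

lemma lip_number_le: "C-lipschitz_on UNIV f \<Longrightarrow> lip_number f \<le> C"
  unfolding lip_number_def by (rule cInf_lower) (auto intro!: bdd_belowI[of _ 0] dest: lipschitz_on_nonneg)

lemma lip_number_nonneg: "C-lipschitz_on UNIV f \<Longrightarrow> 0 \<le> lip_number f"
  unfolding lip_number_def by (rule cInf_greatest) (auto dest: lipschitz_on_nonneg)

text \<open>The sequence serves as its own dominating sequence: a lower bound of all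
  \<open>u n\<close> lies below their pointwise limit, so the infimum in the Riesz space is 0 as
  well. Thus sequential order continuity contains the continuity that Daniell's construction asks
  for.\<close>

lemma order_null_decseq:
  assumes "\<And>n. u n \<in> Lipc A" "\<And>x. decseq (\<lambda>n. u n x)" "\<And>x. (\<lambda>n. u n x) \<longlonglongrightarrow> 0"
  shows "order_null A u"
  unfolding order_null_def
proof (intro exI[of _ u] conjI allI ballI impI)
  have u0: "0 \<le> u n x" for n x using decseq_ge[OF assms(2,3)] .
  then show "(\<lambda>x. 0) \<le> u n" "(\<lambda>x. \<bar>u n x\<bar>) \<le> u n" for n by (auto simp: le_fun_def)
  show "decseq u" using assms(2) by (intro decseq_SucI le_funI) (rule decseq_SucD)
  fix z assume "\<forall>n. z \<le> u n"
  then show "z \<le> (\<lambda>x. 0)"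
    by (auto simp: le_fun_def intro: LIMSEQ_le_const[OF assms(3)])
qed (rule assms(1))

section \<open>Cutoff functions and a compact exhaustion of the complement of A\<close>

locale boundedly_compact_pair =
  fixes A :: "'a::metric_space set"
  assumes closed_A: "closed A" and A_nonempty: "A \<noteq> {}" and boundedly_compact: "boundedly_compact A"
begin

lemma infdist_pos_iff: "0 < infdist x A \<longleftrightarrow> x \<notin> A"
  using in_closed_iff_infdist_zero[OF closed_A A_nonempty, of x] infdist_nonneg[of x A] by auto

text \<open>Bounded compactness speaks of centres off \<open>A\<close>, while the cutoffs below are
  centred at a point of \<open>A\<close>. A larger ball about some \<open>b\<close> off
  \<open>A\<close> contains the given one; if there is no such \<open>b\<close>, the distance to
  \<open>A\<close> vanishes and the set is empty.\<close>

lemma compact_cball_infdist: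
  assumes "0 < e"
  shows "compact (cball a r \<inter> closure {x. e < infdist x A})"
proof (cases "A = UNIV")
  case False
  then obtain b where b: "b \<in> - A" by auto
  \<comment> \<open>The distance of the centres gives the inclusion of the balls, the summand 1
    makes the radius positive.\<close>
  define R where "R = \<bar>r\<bar> + dist a b + 1"
  have "0 < R" unfolding R_def by (smt (verit) zero_le_dist)
  then have "compact (cball b R \<inter> closure {x. e < infdist x A})"
    using boundedly_compact b assms unfolding boundedly_compact_def by blast
  then have c: "compact (cball a r \<inter> (cball b R \<inter> closure {x. e < infdist x A}))"
    by (rule closed_Int_compact[OF closed_cball])
  have "cball a r \<subseteq> cball b R"
  proof
    fix x assume "x \<in> cball a r"
    then show "x \<in> cball b R" using dist_triangle[of b x a] by (auto simp: R_def dist_commute)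
  qed
  then have "cball a r \<inter> (cball b R \<inter> closure {x. e < infdist x A}) = cball a r \<inter> closure {x. e < infdist x A}"
    by blast
  then show ?thesis using c by simp
qed (use assms in simp)

definition base :: 'a where "base = (SOME a. a \<in> A)"

text \<open>Subtracting \<open>inverse (real (Suc n))\<close> clears a neighbourhood of
  \<open>A\<close>, and the radial term makes the support bounded. Combining them by
  \<open>min\<close>, not by a product, keeps the Lipschitz constant 1 for all \<open>n\<close>, so
  that a bounded functional is bounded on all cutoffs at once.\<close>

definition cutoff :: "nat \<Rightarrow> 'a \<Rightarrow> real" where
  "cutoff n x = max 0 (min (infdist x A - inverse (real (Suc n))) (real n - dist x base))"

lemma cutoff_nonneg: "0 \<le> cutoff n x"
  by (simp add: cutoff_def)

lemma cutoff_lipschitz: "1-lipschitz_on U (cutoff n)"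
proof -
  \<comment> \<open>The constant has the shape in which the Lipschitz rules assemble it; its value
    is 1.\<close>
  have "(max 0 (max (1 + 0) (0 + 1)))-lipschitz_on U (cutoff n)"
    unfolding cutoff_def[abs_def]
    by (intro lipschitz_on_max lipschitz_on_min lipschitz_on_diff lipschitz_on_infdist
        lipschitz_on_dist lipschitz_on_constant)
  then show ?thesis by simp
qed

text \<open>Shaped like the sets that bounded compactness declares compact. The pieces carry the
  supports of the cutoffs, exhaust \<open>- A\<close>, and stay away from \<open>A\<close>, which
  makes them of finite measure later on.\<close>

definition piece :: "nat \<Rightarrow> 'a set" where
  "piece n = cball base (real n) \<inter> closure {x. inverse (real (Suc n)) < infdist x A}"

lemma compact_piece: "compact (piece n)"
  unfolding piece_def by (rule compact_cball_infdist) simp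

lemma infdist_piece: "x \<in> piece n \<Longrightarrow> inverse (real (Suc n)) \<le> infdist x A"
proof -
  have "closed {x. inverse (real (Suc n)) \<le> infdist x A}"
    by (intro closed_Collect_le continuous_intros)
  then have "closure {x. inverse (real (Suc n)) < infdist x A} \<subseteq> {x. inverse (real (Suc n)) \<le> infdist x A}"
    by (rule closure_minimal[rotated]) auto
  then show "x \<in> piece n \<Longrightarrow> inverse (real (Suc n)) \<le> infdist x A" by (auto simp: piece_def)
qed

lemma piece_subset: "piece n \<subseteq> - A"
proof
  fix x assume "x \<in> piece n"
  then have "inverse (real (Suc n)) \<le> infdist x A" by (rule infdist_piece)
  then have "0 < infdist x A" by (rule less_le_trans[rotated]) simp
  then show "x \<in> - A" by (simp add: infdist_pos_iff)
qed

lemma cutoff_support: "{x. cutoff n x \<noteq> 0} \<subseteq> piece n"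
proof -
  have "{x. cutoff n x \<noteq> 0} \<subseteq> cball base (real n) \<inter> {x. inverse (real (Suc n)) < infdist x A}"
    by (auto simp: cutoff_def dist_commute)
  then show ?thesis unfolding piece_def using closure_subset by blast
qed

lemma incseq_piece: "incseq piece"
proof (rule incseq_SucI)
  fix n
  have i: "inverse (real (Suc (Suc n))) \<le> inverse (real (Suc n))" by simp
  have "{x. inverse (real (Suc n)) < infdist x A} \<subseteq> {x. inverse (real (Suc (Suc n))) < infdist x A}"
    by (auto intro: le_less_trans[OF i] simp del: of_nat_Suc)
  then show "piece n \<subseteq> piece (Suc n)"
    unfolding piece_def by (intro Int_mono closure_mono subset_cball) auto
qed

lemma cutoff_mono: "cutoff n x \<le> cutoff (Suc n) x"
proof -
  have "inverse (real (Suc (Suc n))) \<le> inverse (real (Suc n))" by simp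
  then show ?thesis unfolding cutoff_def by (intro max.mono min.mono) auto
qed

lemma cutoff_limit: "(\<lambda>n. cutoff n x) \<longlonglongrightarrow> infdist x A"
proof -
  \<comment> \<open>From \<open>N\<close> on the radial term exceeds the distance to
    \<open>A\<close> and drops out of the minimum.\<close>
  obtain N where N: "infdist x A + dist x base \<le> real N" using real_arch_simple by blast
  have "\<forall>\<^sub>F n in sequentially. max 0 (infdist x A - inverse (real (Suc n))) = cutoff n x"
    using eventually_ge_at_top[of N]
  proof eventually_elim
    case (elim n)
    have "infdist x A - inverse (real (Suc n)) \<le> infdist x A" by simp
    also have "\<dots> \<le> real n - dist x base" using N elim by linarith
    finally show ?case by (simp only: cutoff_def min_absorb1)
  qed
  moreover have "(\<lambda>n. max 0 (infdist x A - inverse (real (Suc n)))) \<longlonglongrightarrow> max 0 (infdist x A - 0)"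
    by (intro tendsto_intros LIMSEQ_inverse_real_of_nat)
  ultimately show ?thesis using infdist_nonneg[of x A] by (simp add: Lim_transform_eventually)
qed

lemma cutoff_Lipc: "cutoff n \<in> Lipc A"
  using cutoff_support[of n] piece_subset[of n]
  by (intro LipcI[OF cutoff_lipschitz compact_piece]) auto

lemma cutoff_pos:
  assumes "x \<notin> A"
  shows "\<exists>n. 0 < cutoff n x"
proof -
  have "\<forall>\<^sub>F n in sequentially. 0 < cutoff n x"
    using assms infdist_pos_iff[of x] by (intro order_tendstoD(1)[OF cutoff_limit]) simp
  then show ?thesis by (auto simp: eventually_sequentially)
qed

lemma UN_piece: "(\<Union>n. piece n) = - A"
proof
  show "- A \<subseteq> (\<Union>n. piece n)"
  proof
    fix x assume "x \<in> - A"
    then obtain n where "0 < cutoff n x" using cutoff_pos by auto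
    then have "x \<in> piece n" using subsetD[OF cutoff_support[of n], of x] by simp
    then show "x \<in> (\<Union>n. piece n)" by blast
  qed
qed (use piece_subset in auto)

definition bump :: "'a set \<Rightarrow> nat \<Rightarrow> 'a \<Rightarrow> real" where
  "bump U n x = min (cutoff n x) (infdist x (- U))"

lemma bump_nonneg: "0 \<le> bump U n x"
  by (simp add: bump_def cutoff_nonneg infdist_nonneg)

lemma bump_mono: "bump U n x \<le> bump U (Suc n) x"
  unfolding bump_def using cutoff_mono by (intro min.mono) auto

lemma bump_Lipc: "bump U n \<in> Lipc A"
proof (rule LipcI)
  show "(max 1 1)-lipschitz_on UNIV (bump U n)"
    unfolding bump_def[abs_def] by (intro lipschitz_on_min cutoff_lipschitz lipschitz_on_infdist)
  show "{x. bump U n x \<noteq> 0} \<subseteq> piece n"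
    using cutoff_support[of n] by (auto simp: bump_def min_def infdist_nonneg intro: antisym)
  then show "x \<in> A \<Longrightarrow> bump U n x = 0" for x
    using piece_subset[of n] by auto
qed (rule compact_piece)

lemma bump_support:
  assumes "open U" "U \<subseteq> - A"
  shows "(\<Union>n. {x. 0 < bump U n x}) = U"
proof -
  \<comment> \<open>The distance to the empty set is 0 by convention, which would make every bump
    vanish; \<open>- U\<close> contains the nonempty set \<open>A\<close>.\<close>
  have c: "closed (- U)" "- U \<noteq> {}" using assms A_nonempty by auto
  have i: "0 < infdist x (- U) \<longleftrightarrow> x \<in> U" for x
    using in_closed_iff_infdist_zero[OF c, of x] infdist_nonneg[of x "- U"] by auto
  have "\<exists>n. 0 < bump U n x" if "x \<in> U" for x
  proof -
    have "x \<notin> A" using that assms(2) by blast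
    then obtain n where "0 < cutoff n x" using cutoff_pos by blast
    then show ?thesis using that i by (auto simp: bump_def)
  qed
  then show ?thesis using i by (auto simp: bump_def)
qed

text \<open>The Lipschitz estimate against a point of \<open>A\<close>, where \<open>f\<close>
  vanishes, followed by the infimum over these points. It reduces integrability of every function in
  \<open>Lipc A\<close> to that of the distance to \<open>A\<close>.\<close>

lemma Lipc_le_infdist:
  assumes "C-lipschitz_on UNIV f" "f \<in> Lipc A"
  shows "\<bar>f x\<bar> \<le> C * infdist x A"
proof -
  have C: "0 \<le> C" using assms(1) by (rule lipschitz_on_nonneg)
  have le: "\<bar>f x\<bar> \<le> C * dist x a" if "a \<in> A" for a
    using lipschitz_onD[OF assms(1), of x a] Lipc_zero[OF assms(2) that] by (simp add: dist_real_def)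
  show ?thesis
  proof (cases "C = 0")
    case True
    then show ?thesis using le A_nonempty by auto
  next
    case False
    then have "0 < C" using C by simp
    then have "\<bar>f x\<bar> / C \<le> infdist x A"
      unfolding infdist_notempty[OF A_nonempty] using le A_nonempty
      by (intro cINF_greatest) (auto simp: field_simps)
    then show ?thesis using \<open>0 < C\<close> by (simp add: field_simps)
  qed
qed

end

lemma infdist_measurable [measurable]:
  "(\<lambda>x::'a::metric_space. infdist x A) \<in> borel_measurable borel"
  by (intro borel_measurable_continuous_onI continuous_intros)

section \<open>The representing measure: Borel sets, first moment, tightness\<close>

locale Lipc_integral = boundedly_compact_pair A + daniell_integral "Lipc A" P
  for A :: "'a::metric_space set" and P +
  assumes P_bounded: "bounded_functional A P"
begin

text \<open>
  A set that meets \<open>A\<close> has no countable cover by functions vanishing on \<open>A\<close>, so it gets outer measure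
  \<open>\<infinity>\<close>; this is harmless, since only the values on subsets of \<open>- A\<close> matter.
\<close>

lemma outer_eq_top: "E \<inter> A \<noteq> {} \<Longrightarrow> outer E = top"
proof -
  assume "E \<inter> A \<noteq> {}"
  then obtain x where x: "x \<in> E" "x \<in> A" by auto
  have "majorants (indicator E) = {}"
  proof (rule equals0I)
    fix g assume g: "g \<in> majorants (indicator E)"
    then have "g i \<in> Lipc A" for i by (auto simp: majorants_def Lp_def)
    then have "g i x = 0" for i using x(2) by (rule Lipc_zero)
    moreover have "indicator E x \<le> (\<Sum>i. ennreal (g i x))"
      using g unfolding majorants_def by blast
    ultimately show False using x by simp
  qed
  then show "outer E = top" by (simp add: outer_def upper_integral_def)
qed

text \<open>An open set off \<open>A\<close> is a countable union of positivity sets of bumps. Every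
  subset \<open>B\<close> of \<open>A\<close> is measurable for a trivial reason: a test set either
  misses \<open>B\<close>, or both sides of the Caratheodory identity are infinite.\<close>

lemma sets_borel_subset: "sets borel \<subseteq> lambda_system UNIV (Pow UNIV) outer" (is "_ \<subseteq> ?S")
proof -
  interpret S: sigma_algebra UNIV ?S
    using sigma_algebra.caratheodory_lemma[OF sigma_algebra_Pow outer_measure_space_outer]
    by (simp add: measure_space_def)
  have A_sub: "B \<in> ?S" if "B \<subseteq> A" for B
  proof -
    have "outer (B \<inter> E) + outer ((UNIV - B) \<inter> E) = outer E" for E
    proof (cases "E \<inter> B = {}")
      case True
      then have "B \<inter> E = {}" "(UNIV - B) \<inter> E = E" by auto
      then show ?thesis
        using outer_measure_space_outer by (simp add: outer_measure_space_def positive_def)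
    next
      case False
      then have "outer (B \<inter> E) = top" "outer E = top" using that by (auto intro!: outer_eq_top)
      then show ?thesis by simp
    qed
    then show ?thesis by (simp add: lambda_system_def)
  qed
  have "U \<in> ?S" if "open U" for U
  proof -
    have "open (U \<inter> - A)" using that closed_A by auto
    then have "U \<inter> - A = (\<Union>n. {x. 0 < bump (U \<inter> - A) n x})" by (subst bump_support) auto
    also have "\<dots> \<in> ?S"
      by (intro S.countable_UN image_subsetI positive_set_lambda_system LpI bump_Lipc bump_nonneg)
    finally have "U \<inter> - A \<in> ?S" .
    moreover have "U \<inter> A \<in> ?S" by (rule A_sub) simp
    ultimately have "(U \<inter> - A) \<union> (U \<inter> A) \<in> ?S" by (rule S.Un)
    moreover have "(U \<inter> - A) \<union> (U \<inter> A) = U" by blast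
    ultimately show ?thesis by simp
  qed
  then have "sigma_sets UNIV {S. open S} \<subseteq> ?S" by (intro S.sigma_sets_subset) auto
  then show ?thesis by (simp add: borel_def)
qed

definition measure_rep :: "'a measure" where
  "measure_rep = measure_of UNIV (sets borel) outer"

lemma sets_measure_rep [simp, measurable_cong]: "sets measure_rep = sets borel"
  using sets.sets_measure_of_eq[of borel outer] by (simp add: measure_rep_def)

lemma space_measure_rep [simp]: "space measure_rep = UNIV"
  by (simp add: measure_rep_def space_measure_of_conv)

lemma emeasure_measure_rep: "E \<in> sets borel \<Longrightarrow> emeasure measure_rep E = outer E"
  unfolding measure_rep_def
  using sets.sigma_algebra_axioms[of borel] sets_borel_subset
  by (intro emeasure_measure_of_outer) auto

lemma Lipc_measurable_rep: "f \<in> Lipc A \<Longrightarrow> f \<in> borel_measurable measure_rep"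
  using Lipc_measurable by (simp add: measurable_cong_sets[OF sets_measure_rep refl])

lemma nn_integral_measure_rep: "f \<in> Lp \<Longrightarrow> (\<integral>\<^sup>+x. ennreal (f x) \<partial>measure_rep) = ennreal (P f)"
  by (rule nn_integral_eq_I) (auto simp: emeasure_measure_rep Lp_def intro: Lipc_measurable_rep)

lemma integral_measure_rep:
  assumes f: "f \<in> Lipc A"
  shows "P f = (\<integral>x. f x \<partial>measure_rep)"
proof -
  have *: "has_bochner_integral measure_rep f (P f)" if "f \<in> Lp" for f
    using that Lipc_measurable_rep[of f] nn_integral_measure_rep[OF that] I_Lp_nonneg[OF that]
    by (intro has_bochner_integral_nn_integral) (auto simp: Lp_def)
  let ?p = "\<lambda>x. max (f x) 0" and ?n = "\<lambda>x. max (- f x) 0"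
  have L: "?p \<in> Lp" "?n \<in> Lp" using f by (auto intro!: LpI max_mem zero_mem uminus_mem)
  have eq: "(\<lambda>x. ?p x - ?n x) = f" by (auto simp: max_def)
  have "has_bochner_integral measure_rep f (P ?p - P ?n)"
    using has_bochner_integral_diff[OF *[OF L(1)] *[OF L(2)]] by (simp only: eq)
  moreover have "P ?p - P ?n = P f" using I_diff[of ?p ?n] L LpD(1) by (simp add: eq)
  ultimately show ?thesis by (simp add: has_bochner_integral_integral_eq)
qed

lemma nn_integral_infdist_measure_rep: "(\<integral>\<^sup>+x. ennreal (infdist x A) \<partial>measure_rep) < \<infinity>"
proof -
  obtain M where M: "\<And>f. f \<in> Lipc A \<Longrightarrow> \<bar>P f\<bar> \<le> M * lip_number f"
    using P_bounded by (auto simp: bounded_functional_def)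
  have inc: "incseq (\<lambda>n x. ennreal (cutoff n x))"
    using cutoff_mono by (intro incseq_SucI le_funI ennreal_leI)
  have sup: "ennreal (infdist x A) = (SUP n. ennreal (cutoff n x))" for x
    using inc by (intro LIMSEQ_unique[OF tendsto_ennrealI[OF cutoff_limit] LIMSEQ_SUP])
      (auto simp: incseq_def le_fun_def)
  have "(\<integral>\<^sup>+x. ennreal (infdist x A) \<partial>measure_rep) = (SUP n. \<integral>\<^sup>+x. ennreal (cutoff n x) \<partial>measure_rep)"
    unfolding sup using Lipc_measurable_rep[OF cutoff_Lipc]
    by (intro nn_integral_monotone_convergence_SUP inc) auto
  also have "\<dots> \<le> ennreal \<bar>M\<bar>"
  proof (rule SUP_least)
    fix n
    have "P (cutoff n) \<le> M * lip_number (cutoff n)" using M[OF cutoff_Lipc[of n]] by simp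
    \<comment> \<open>\<open>bounded_functional\<close> says nothing about the sign of
      \<open>M\<close>, hence the absolute value.\<close>
    also have "\<dots> \<le> \<bar>M\<bar> * 1"
      using lip_number_le[OF cutoff_lipschitz] lip_number_nonneg[OF cutoff_lipschitz]
      by (intro mult_mono) auto
    finally show "(\<integral>\<^sup>+x. ennreal (cutoff n x) \<partial>measure_rep) \<le> ennreal \<bar>M\<bar>"
      using nn_integral_measure_rep[OF LpI[OF cutoff_Lipc cutoff_nonneg]] by (simp add: ennreal_leI)
  qed
  also have "\<dots> < \<infinity>" by simp
  finally show ?thesis .
qed

text \<open>The partial sums of a majorizing series are continuous, so the sets where they exceed a
  level are open. On \<open>D\<close> the series is only known to be at least 1, and its partial
  sums may never exceed 1; stretching it by a factor \<open>r > 1\<close> makes the inequality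
  strict at a small cost.\<close>

lemma outer_regular:
  assumes fin: "outer D \<noteq> \<infinity>" and e: "0 < e"
  obtains U where "open U" "D \<subseteq> U" "outer U \<le> outer D + ennreal e"
proof -
  obtain c where c: "0 \<le> c" "outer D = ennreal c" using fin by (cases "outer D") auto
  obtain g where g: "\<And>i. g i \<in> Lp" "\<And>x. indicator D x \<le> (\<Sum>i. ennreal (g i x))"
      "(\<Sum>i. ennreal (P (g i))) < outer D + ennreal (e / 2)"
    using upper_integral_approx[of "indicator D" "e / 2"] fin e by (auto simp: outer_def)
  \<comment> \<open>Chosen so that stretching a series of total at most \<open>c + e / 2\<close>
    gives at most \<open>c + e\<close>.\<close>
  define r where "r = (c + e) / (c + e / 2)"
  have r: "1 < r" "r * (c + e / 2) = c + e" using c e by (auto simp: r_def field_simps)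
  define U where "U = (\<Union>n. {x. 1 < r * (\<Sum>i<n. g i x)})"
  have g0: "0 \<le> g i x" for i x using g(1) LpD(2) by blast
  show thesis
  proof
    show "open U"
      unfolding U_def using g(1) LpD(1)
      by (intro open_UN ballI open_Collect_less continuous_intros Lipc_continuous) auto
    show "D \<subseteq> U"
    proof
      fix x assume x: "x \<in> D"
      show "x \<in> U"
      proof (rule ccontr)
        assume "x \<notin> U"
        then have "(\<Sum>i<n. g i x) \<le> 1 / r" for n
          using r by (auto simp: U_def field_simps not_less)
        then have "(\<Sum>i<n. ennreal (g i x)) \<le> ennreal (1 / r)" for n
          using g0 by (simp add: sum_ennreal ennreal_leI)
        then have "(\<Sum>i. ennreal (g i x)) \<le> ennreal (1 / r)"
          by (intro suminf_le_const) auto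
        also have "\<dots> < 1" using r by (simp add: ennreal_less_one_iff)
        also have "1 \<le> (\<Sum>i. ennreal (g i x))" using g(2)[of x] x by simp
        finally show False by simp
      qed
    qed
    have "outer U \<le> (\<Sum>i. ennreal (P (\<lambda>x. r * g i x)))"
      unfolding outer_def
    proof (rule upper_integral_le)
      show "(\<lambda>x. r * g i x) \<in> Lp" for i
        using g(1)[of i] g0 r by (auto simp: Lp_def intro!: scale_mem)
      show "indicator U x \<le> (\<Sum>i. ennreal (r * g i x))" for x
      proof (cases "x \<in> U")
        case True
        then obtain n where n: "1 < r * (\<Sum>i<n. g i x)" by (auto simp: U_def)
        have "1 \<le> ennreal (r * (\<Sum>i<n. g i x))" using n by (simp add: ennreal_ge_1)
        also have "\<dots> = (\<Sum>i<n. ennreal (r * g i x))"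
          using g0 r by (simp add: sum_distrib_left sum_ennreal)
        also have "\<dots> \<le> (\<Sum>i. ennreal (r * g i x))" by (intro sum_le_suminf) auto
        finally show ?thesis using True by simp
      qed simp
    qed
    also have "\<dots> = ennreal r * (\<Sum>i. ennreal (P (g i)))"
      using r g(1) LpD(1) by (simp add: I_scale ennreal_mult' I_Lp_nonneg)
    also have "\<dots> \<le> ennreal r * ennreal (c + e / 2)"
      using g(3) c e by (intro mult_left_mono) auto
    also have "\<dots> = ennreal (c + e)"
      using r(1) by (simp only: ennreal_mult'[symmetric] r(2))
    also have "\<dots> = outer D + ennreal e" using c e by simp
    finally show "outer U \<le> outer D + ennreal e" .
  qed
qed

text \<open>Inside a compact piece, inner approximation of \<open>E\<close> is outer approximation
  of the rest of the piece. On \<open>piece n\<close> the distance to \<open>A\<close> is at least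
  \<open>1 / Suc n\<close>, so the piece has finite measure; this makes \<open>outer_regular\<close>
  applicable and allows the measure of the rest to be cancelled.\<close>

lemma tight_measure_rep: "tight_off A measure_rep"
  unfolding tight_off_def
proof (intro ballI impI antisym)
  fix E :: "'a set" assume E: "E \<in> sets borel" "E \<subseteq> - A"
  let ?\<mu> = "emeasure measure_rep"
  let ?s = "SUP K\<in>{K. compact K \<and> K \<subseteq> E}. ?\<mu> K"
  show "?s \<le> ?\<mu> E" using E by (intro SUP_least emeasure_mono) auto
  have pb: "piece n \<in> sets borel" for n using compact_piece by (rule borel_compact)
  have fin: "?\<mu> (piece n) < \<infinity>" for n
  proof -
    have "?\<mu> (piece n) = (\<integral>\<^sup>+x. indicator (piece n) x \<partial>measure_rep)" using pb by simp
    also have "\<dots> \<le> (\<integral>\<^sup>+x. ennreal (real (Suc n)) * ennreal (infdist x A) \<partial>measure_rep)"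
    proof (rule nn_integral_mono)
      fix x
      show "indicator (piece n) x \<le> ennreal (real (Suc n)) * ennreal (infdist x A)"
      proof (cases "x \<in> piece n")
        case True
        then have "1 \<le> real (Suc n) * infdist x A"
          using infdist_piece[OF True] by (simp add: field_simps del: of_nat_Suc)
        then show ?thesis using True infdist_nonneg[of x A]
          by (simp add: ennreal_mult[symmetric] ennreal_ge_1 del: of_nat_Suc)
      qed simp
    qed
    also have "\<dots> = ennreal (real (Suc n)) * (\<integral>\<^sup>+x. ennreal (infdist x A) \<partial>measure_rep)"
      by (rule nn_integral_cmult) measurable
    also have "\<dots> < \<infinity>" using nn_integral_infdist_measure_rep by (simp add: ennreal_mult_less_top)
    finally show ?thesis .
  qed
  have "(\<Union>n. E \<inter> piece n) = E" using E UN_piece by auto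
  moreover have "incseq (\<lambda>n. E \<inter> piece n)"
    using incseq_SucD[OF incseq_piece] by (intro incseq_SucI Int_mono) auto
  ultimately have "?\<mu> E = (SUP n. ?\<mu> (E \<inter> piece n))"
    using E pb by (subst SUP_emeasure_incseq) auto
  also have "\<dots> \<le> ?s"
  proof (rule SUP_least, rule ennreal_le_epsilon)
    fix n and e :: real assume e: "0 < e"
    let ?D = "piece n - E"
    have Db: "?D \<in> sets borel" using E pb by auto
    have "?\<mu> ?D \<le> ?\<mu> (piece n)" using E pb by (intro emeasure_mono) auto
    then have Dfin: "?\<mu> ?D < \<infinity>" using fin[of n] by (rule le_less_trans)
    then have "outer ?D \<noteq> \<infinity>" using emeasure_measure_rep[OF Db] by simp
    then obtain U where U: "open U" "?D \<subseteq> U" "outer U \<le> outer ?D + ennreal e"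
      using e by (rule outer_regular)
    \<comment> \<open>It lies in \<open>E\<close> because \<open>U\<close> covers everything in the
      piece outside \<open>E\<close>.\<close>
    let ?K = "piece n - U"
    have K: "compact ?K" "?K \<subseteq> E" using U compact_piece by (auto intro: compact_diff)
    have Kb: "?K \<in> sets borel" "U \<in> sets borel" using K(1) U(1) by (auto intro: borel_compact)
    have "?\<mu> ?D + ?\<mu> (E \<inter> piece n) = ?\<mu> (?D \<union> (E \<inter> piece n))"
      using Db E pb by (intro plus_emeasure) auto
    also have "\<dots> \<le> ?\<mu> (U \<union> ?K)" using Kb U pb by (intro emeasure_mono) auto
    also have "\<dots> \<le> ?\<mu> U + ?\<mu> ?K" using Kb by (intro emeasure_subadditive) auto
    also have "\<dots> \<le> (?\<mu> ?D + ennreal e) + ?\<mu> ?K"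
      using U Kb Db by (intro add_right_mono) (simp add: emeasure_measure_rep)
    finally have "?\<mu> ?D + ?\<mu> (E \<inter> piece n) \<le> ?\<mu> ?D + (?\<mu> ?K + ennreal e)" by (simp add: ac_simps)
    then have "?\<mu> (E \<inter> piece n) \<le> ?\<mu> ?K + ennreal e"
      using Dfin by (auto simp: ennreal_add_left_cancel_le)
    also have "\<dots> \<le> ?s + ennreal e" using K by (intro add_right_mono SUP_upper) auto
    finally show "?\<mu> (E \<inter> piece n) \<le> ?s + ennreal e" .
  qed
  finally show "?\<mu> E \<le> ?s" .
qed

end

section \<open>Relative measures: representatives, integrals and uniqueness\<close>

context boundedly_compact_pair
begin

definition M1_representative :: "'a measure \<Rightarrow> bool" where
  "M1_representative \<mu> \<longleftrightarrow> \<mu> \<in> borel_measures \<and> tight_off A \<mu> \<and> (\<integral>\<^sup>+x. ennreal (infdist x A) \<partial>\<mu>) < \<infinity>"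

lemma M1_representativeD:
  assumes "M1_representative \<mu>"
  shows "sets \<mu> = sets borel" "space \<mu> = UNIV" "tight_off A \<mu>" "(\<integral>\<^sup>+x. ennreal (infdist x A) \<partial>\<mu>) < \<infinity>"
  using assms sets_eq_imp_space_eq[of \<mu> borel] by (auto simp: M1_representative_def borel_measures_def)

lemma rel_measure_rel_nn_integral_eq:
  assumes rel: "(\<mu>, \<nu>) \<in> rel_measure_rel A"
    and f: "f \<in> borel_measurable borel" "\<And>x. x \<in> A \<Longrightarrow> f x = (0::ennreal)"
  shows "(\<integral>\<^sup>+x. f x \<partial>\<mu>) = (\<integral>\<^sup>+x. f x \<partial>\<nu>)"
proof -
  have s: "sets \<mu> = sets borel" "sets \<nu> = sets borel"
    and eq: "\<And>E. E \<in> sets borel \<Longrightarrow> E \<subseteq> - A \<Longrightarrow> emeasure \<mu> E = emeasure \<nu> E"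
    using rel rel_measure_rel_iff[OF closed_A] by (auto simp: borel_measures_def)
  have sp: "space \<mu> = UNIV" "space \<nu> = UNIV" 
    using sets_eq_imp_space_eq[OF s(1)] sets_eq_imp_space_eq[OF s(2)] by simp_all
  have B: "- A \<in> sets borel" using closed_A by auto
  have int: "(\<integral>\<^sup>+x. f x \<partial>M) = (\<integral>\<^sup>+x. f x \<partial>restrict_space M (- A))"
    if "sets M = sets borel" "space M = UNIV" for M
    using that B f(2) by (subst nn_integral_restrict_space)
      (auto intro!: nn_integral_cong simp: indicator_def)
  have "restrict_space \<mu> (- A) = restrict_space \<nu> (- A)"
  proof (rule measure_eqI)
    show "sets (restrict_space \<mu> (- A)) = sets (restrict_space \<nu> (- A))"
      using s by (simp add: sets_restrict_space)
    fix E assume "E \<in> sets (restrict_space \<mu> (- A))"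
    then have "E \<in> sets borel" "E \<subseteq> - A"
      using s B sp by (auto simp: sets_restrict_space_iff)
    then show "emeasure (restrict_space \<mu> (- A)) E = emeasure (restrict_space \<nu> (- A)) E"
      using s B sp eq by (simp add: emeasure_restrict_space)
  qed
  then show ?thesis using int s sp by metis
qed

lemma M1_plus_class:
  assumes "M1_representative \<mu>"
  shows "rel_measure_rel A `` {\<mu>} \<in> M1_plus A"
proof -
  have "tight_off A \<nu> \<and> (\<integral>\<^sup>+x. ennreal (infdist x A) \<partial>\<nu>) < \<infinity>" if rel: "(\<mu>, \<nu>) \<in> rel_measure_rel A" for \<nu>
  proof
    have eq: "\<And>E. E \<in> sets borel \<Longrightarrow> E \<subseteq> - A \<Longrightarrow> emeasure \<mu> E = emeasure \<nu> E"
      using rel rel_measure_rel_iff[OF closed_A] by auto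
    show "tight_off A \<nu>"
      unfolding tight_off_def
    proof (intro ballI impI)
      fix E :: "'a set" assume E: "E \<in> sets borel" "E \<subseteq> - A"
      then have "emeasure \<nu> E = (SUP K\<in>{K. compact K \<and> K \<subseteq> E}. emeasure \<mu> K)"
        using assms eq[OF E] by (auto simp: M1_representative_def tight_off_def)
      also have "\<dots> = (SUP K\<in>{K. compact K \<and> K \<subseteq> E}. emeasure \<nu> K)"
        using E by (intro SUP_cong refl eq) (auto intro: borel_compact)
      finally show "emeasure \<nu> E = (SUP K\<in>{K. compact K \<and> K \<subseteq> E}. emeasure \<nu> K)" .
    qed
    have "(\<integral>\<^sup>+x. ennreal (infdist x A) \<partial>\<mu>) = (\<integral>\<^sup>+x. ennreal (infdist x A) \<partial>\<nu>)"
      by (rule rel_measure_rel_nn_integral_eq[OF rel]) (simp_all add: infdist_measurable)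
    then show "(\<integral>\<^sup>+x. ennreal (infdist x A) \<partial>\<nu>) < \<infinity>" using M1_representativeD(4)[OF assms] by simp
  qed
  then show ?thesis
    using assms by (auto simp: M1_plus_def rel_measures_def M1_representative_def intro: quotientI)
qed

lemma M1_plusE:
  assumes "M \<in> M1_plus A"
  obtains \<mu> where "M1_representative \<mu>" "M = rel_measure_rel A `` {\<mu>}"
proof -
  have "M \<in> borel_measures // rel_measure_rel A" using assms by (simp add: M1_plus_def rel_measures_def)
  then obtain \<mu> where \<mu>: "\<mu> \<in> borel_measures" "M = rel_measure_rel A `` {\<mu>}" by (rule quotientE)
  then have "\<mu> \<in> M" using equiv_class_self[OF equiv_rel_measure_rel[OF closed_A]] by blast
  then show thesis using that \<mu> assms by (auto simp: M1_plus_def M1_representative_def)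
qed

text \<open>All representatives give the same integral, so the image of the class is a singleton and
  \<open>the_elem\<close> returns that value.\<close>

lemma rel_integral_class:
  assumes "M1_representative \<mu>" "f \<in> Lipc A"
  shows "rel_integral (rel_measure_rel A `` {\<mu>}) f = (\<integral>x. f x \<partial>\<mu>)"
proof -
  let ?C = "rel_measure_rel A `` {\<mu>}"
  have "(\<lambda>\<nu>. \<integral>x. f x \<partial>\<nu>) ` ?C \<subseteq> {\<integral>x. f x \<partial>\<mu>}"
  proof (rule image_subsetI)
    fix \<nu> assume "\<nu> \<in> ?C"
    then have rel: "(\<mu>, \<nu>) \<in> rel_measure_rel A" by simp
    have "(\<integral>x. f x \<partial>\<mu>) = (\<integral>x. f x \<partial>\<nu>)"
      by (rule rel_measure_rel_integral_eq[OF closed_A rel Lipc_measurable[OF assms(2)] Lipc_zero[OF assms(2)]])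
    then show "(\<integral>x. f x \<partial>\<nu>) \<in> {\<integral>x. f x \<partial>\<mu>}" by simp
  qed
  moreover have "\<mu> \<in> ?C"
    using assms(1) equiv_class_self[OF equiv_rel_measure_rel[OF closed_A]]
    by (auto simp: M1_representative_def)
  then have "(\<integral>x. f x \<partial>\<mu>) \<in> (\<lambda>\<nu>. \<integral>x. f x \<partial>\<nu>) ` ?C" by (rule imageI)
  ultimately have "(\<lambda>\<nu>. \<integral>x. f x \<partial>\<nu>) ` ?C = {\<integral>x. f x \<partial>\<mu>}" by blast
  then show ?thesis by (simp add: rel_integral_def)
qed

lemma M1_representative_integrable:
  assumes \<mu>: "M1_representative \<mu>" and f: "f \<in> Lipc A"
  shows "integrable \<mu> f"
proof -
  obtain C where C: "C-lipschitz_on UNIV f" using f by (rule LipcE)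
  have m: "f \<in> borel_measurable \<mu>" "(\<lambda>x. infdist x A) \<in> borel_measurable \<mu>"
    using Lipc_measurable[OF f] M1_representativeD(1)[OF \<mu>]
    by (simp_all cong: measurable_cong_sets add: infdist_measurable)
  have "integrable \<mu> (\<lambda>x. infdist x A)"
    using m(2) M1_representativeD(4)[OF \<mu>] by (intro integrableI_bounded) (simp_all add: infdist_nonneg)
  then have "integrable \<mu> (\<lambda>x. C * infdist x A)" by simp
  then show ?thesis
    by (rule Bochner_Integration.integrable_bound[OF _ m(1)])
      (use Lipc_le_infdist[OF C f] in \<open>auto intro!: AE_I2 intro: order_trans[OF _ abs_ge_self]\<close>)
qed

text \<open>Expresses the measure of an open set through integrals of functions in
  \<open>Lipc A\<close>, so that these integrals determine it.\<close>

lemma emeasure_open_eq_SUP: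
  assumes \<mu>: "M1_representative \<mu>" and U: "open U" "U \<subseteq> - A"
  shows "emeasure \<mu> U = (SUP n. ennreal (\<integral>x. min (real n * bump U n x) 1 \<partial>\<mu>))"
proof -
  let ?\<phi> = "\<lambda>n x. min (real n * bump U n x) 1"
  interpret function_lattice "Lipc A" by (rule function_lattice_Lipc)
  have L: "?\<phi> n \<in> Lipc A" for n by (intro Lipc_min_one scale_mem bump_Lipc)
  have inc: "incseq (\<lambda>n x. ennreal (?\<phi> n x))"
  proof (intro incseq_SucI le_funI ennreal_leI)
    show "?\<phi> n x \<le> ?\<phi> (Suc n) x" for n x
      using mult_mono[OF _ bump_mono[of U n x], of "real n" "real (Suc n)"] bump_nonneg
      by (intro min.mono) auto
  qed
  have sup: "(SUP n. ennreal (?\<phi> n x)) = indicator U x" for x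
  proof (cases "x \<in> U")
    case True
    then obtain n0 where n0: "0 < bump U n0 x" using bump_support[OF U] by auto
    obtain N where N: "1 / bump U n0 x \<le> real N" using real_arch_simple by blast
    \<comment> \<open>The index \<open>n0\<close> makes the bump positive at \<open>x\<close>, and
      the factor \<open>N\<close> lifts that value to at least 1.\<close>
    let ?n = "max n0 N"
    have "incseq (\<lambda>n. bump U n x)" by (rule incseq_SucI) (rule bump_mono)
    then have "bump U n0 x \<le> bump U ?n x" by (rule incseqD) simp
    moreover have "1 \<le> real N * bump U n0 x" using N n0 by (simp add: field_simps)
    moreover have "real N * bump U n0 x \<le> real ?n * bump U ?n x"
      using calculation(1) n0 by (intro mult_mono) auto
    ultimately have "?\<phi> ?n x = 1" by simp
    then have "1 \<le> (SUP n. ennreal (?\<phi> n x))" by (intro SUP_upper2[of ?n]) auto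
    moreover have "(SUP n. ennreal (?\<phi> n x)) \<le> 1" by (intro SUP_least) (simp add: ennreal_le_1)
    ultimately show ?thesis using True by simp
  next
    case False
    then have "\<not> 0 < bump U n x" for n using bump_support[OF U] by blast
    then have "bump U n x = 0" for n
      using bump_nonneg[of U n x] by (meson antisym not_less)
    then show ?thesis using False by simp
  qed
  have "U \<in> sets \<mu>" using U M1_representativeD(1)[OF \<mu>] by simp
  then have "emeasure \<mu> U = (\<integral>\<^sup>+x. (SUP n. ennreal (?\<phi> n x)) \<partial>\<mu>)" by (simp add: sup)
  also have "\<dots> = (SUP n. \<integral>\<^sup>+x. ennreal (?\<phi> n x) \<partial>\<mu>)"
    using M1_representative_integrable[OF \<mu> L] by (intro nn_integral_monotone_convergence_SUP inc) auto
  also have "\<dots> = (SUP n. ennreal (\<integral>x. ?\<phi> n x \<partial>\<mu>))"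
    using M1_representative_integrable[OF \<mu> L] bump_nonneg
    by (intro SUP_cong refl nn_integral_eq_integral AE_I2) auto
  finally show ?thesis .
qed

text \<open>Equal integrals give equal values on open sets off \<open>A\<close>. A compact set is
  the difference of two such open sets of finite measure, and tightness passes from compact sets to
  all Borel sets off \<open>A\<close>.\<close>

lemma M1_representative_unique:
  assumes \<mu>: "M1_representative \<mu>" and \<nu>: "M1_representative \<nu>"
    and eq: "\<And>f. f \<in> Lipc_pos A \<Longrightarrow> (\<integral>x. f x \<partial>\<mu>) = (\<integral>x. f x \<partial>\<nu>)"
  shows "(\<mu>, \<nu>) \<in> rel_measure_rel A"
proof -
  interpret function_lattice "Lipc A" by (rule function_lattice_Lipc)
  have "(\<lambda>x. min (real n * bump U n x) 1) \<in> Lipc_pos A" for n U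
    using bump_nonneg by (auto simp: Lipc_pos_def intro!: Lipc_min_one scale_mem bump_Lipc)
  then have open_eq: "emeasure \<mu> U = emeasure \<nu> U" if "open U" "U \<subseteq> - A" for U
    using that by (simp add: emeasure_open_eq_SUP[OF \<mu>] emeasure_open_eq_SUP[OF \<nu>] eq)
  have compact_eq: "emeasure \<mu> K = emeasure \<nu> K" if K: "compact K" "K \<subseteq> - A" for K
  proof (cases "K = {}")
    case False
    have "continuous_on K (\<lambda>x. infdist x A)" by (intro continuous_intros)
    then obtain x0 where x0: "x0 \<in> K" "\<And>x. x \<in> K \<Longrightarrow> infdist x0 A \<le> infdist x A"
      using continuous_attains_inf[OF K(1) False] by blast
    \<comment> \<open>Half the smallest distance of \<open>K\<close> from \<open>A\<close>. The open
      set \<open>U\<close> of points farther than \<delta> from \<open>A\<close> then contains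
      \<open>K\<close>, and Markov's inequality makes its measure finite.\<close>
    define \<delta> where "\<delta> = infdist x0 A / 2"
    have \<delta>: "0 < \<delta>" using x0(1) K(2) infdist_pos_iff by (auto simp: \<delta>_def)
    define U where "U = {x. \<delta> < infdist x A}"
    have U: "open U" "U \<subseteq> - A"
      unfolding U_def by (intro open_Collect_less continuous_intros) (use \<delta> in auto)
    have KU: "K \<subseteq> U"
    proof
      fix x assume "x \<in> K"
      then show "x \<in> U" using x0(2)[of x] \<delta> unfolding U_def \<delta>_def by simp
    qed
    have diff: "emeasure M K = emeasure M U - emeasure M (U - K)" if M: "M1_representative M" for M
    proof -
      note s = M1_representativeD[OF M]
      have "ennreal \<delta> * emeasure M U = (\<integral>\<^sup>+x. ennreal \<delta> * indicator U x \<partial>M)"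
        using U s by (intro nn_integral_cmult_indicator[symmetric]) auto
      also have "\<dots> \<le> (\<integral>\<^sup>+x. ennreal (infdist x A) \<partial>M)"
        by (intro nn_integral_mono) (auto simp: indicator_def U_def intro: ennreal_leI)
      also have "\<dots> < \<infinity>" by (rule s)
      finally have fU: "emeasure M U \<noteq> \<infinity>" using \<delta> by (auto simp: ennreal_mult_top)
      have "emeasure M (U - K) \<le> emeasure M U" using U s by (intro emeasure_mono) auto
      with fU have "emeasure M (U - K) \<noteq> \<infinity>" by (auto simp: top_unique)
      moreover have "U - K \<in> sets M" "U \<in> sets M" using U K s by (auto intro: borel_compact)
      ultimately have "emeasure M (U - (U - K)) = emeasure M U - emeasure M (U - K)"
        by (intro emeasure_Diff) auto
      moreover have "U - (U - K) = K" using KU by auto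
      ultimately show ?thesis by simp
    qed
    have "open (U - K)" using U(1) K(1) compact_imp_closed by blast
    moreover have "U - K \<subseteq> - A" using U(2) by blast
    ultimately have "emeasure \<mu> (U - K) = emeasure \<nu> (U - K)" by (rule open_eq)
    then show ?thesis using diff[OF \<mu>] diff[OF \<nu>] open_eq[OF U] by simp
  qed simp
  have "emeasure \<mu> E = emeasure \<nu> E" if E: "E \<in> sets borel" "E \<subseteq> - A" for E
  proof -
    have "emeasure \<mu> E = (SUP K\<in>{K. compact K \<and> K \<subseteq> E}. emeasure \<mu> K)"
      using M1_representativeD(3)[OF \<mu>] E by (simp add: tight_off_def)
    also have "\<dots> = (SUP K\<in>{K. compact K \<and> K \<subseteq> E}. emeasure \<nu> K)"
      using E by (intro SUP_cong refl compact_eq) auto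
    also have "\<dots> = emeasure \<nu> E"
      using M1_representativeD(3)[OF \<nu>] E by (simp add: tight_off_def)
    finally show ?thesis .
  qed
  then show ?thesis
    using \<mu> \<nu> by (auto simp: rel_measure_rel_iff[OF closed_A] M1_representative_def)
qed

end

lemma (in Lipc_integral) M1_representative_measure_rep: "M1_representative measure_rep"
  using tight_measure_rep nn_integral_infdist_measure_rep
  by (simp add: M1_representative_def borel_measures_def)

section \<open>The infimum over decompositions and the modulus of the functional\<close>

context order_bounded_form
begin

text \<open>With \<open>g = f - h\<close> the sum \<open>p g + q h\<close> becomes
  \<open>p f - T h\<close>, where \<open>h\<close> runs through \<open>below f\<close>; the infimum
  thus turns into the supremum that defines \<open>pos f\<close>.\<close>

lemma Inf_decomposition_eq:
  assumes f: "f \<in> L" "\<And>x. 0 \<le> f x"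
    and p: "\<And>g h. g \<in> L \<Longrightarrow> h \<in> L \<Longrightarrow> p (\<lambda>x. g x + h x) = p g + p h"
    and q: "\<And>h. h \<in> L \<Longrightarrow> T h = p h - q h"
  shows "Inf {p g + q h | g h. g \<in> {g \<in> L. \<forall>x. 0 \<le> g x} \<and> h \<in> {g \<in> L. \<forall>x. 0 \<le> g x} \<and>
    (\<lambda>x. g x + h x) = f} = p f - pos f"
proof -
  have "{p g + q h | g h. g \<in> {g \<in> L. \<forall>x. 0 \<le> g x} \<and> h \<in> {g \<in> L. \<forall>x. 0 \<le> g x} \<and>
      (\<lambda>x. g x + h x) = f} = (\<lambda>h. p f - T h) ` below f" (is "?S = _")
  proof (intro equalityI subsetI)
    fix s assume "s \<in> ?S"
    then obtain g h where s: "s = p g + q h" and gh: "g \<in> L" "\<And>x. 0 \<le> g x" "h \<in> L" "\<And>x. 0 \<le> h x"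
      and eq: "(\<lambda>x. g x + h x) = f" by blast
    have "h x \<le> f x" for x using gh(2)[of x] by (simp add: eq[symmetric])
    then have "h \<in> below f" using gh by (intro belowI)
    moreover have "s = p f - T h" using s p[OF gh(1,3)] q[OF gh(3)] by (simp add: eq)
    ultimately show "s \<in> (\<lambda>h. p f - T h) ` below f" by blast
  next
    fix s assume "s \<in> (\<lambda>h. p f - T h) ` below f"
    then obtain h where h: "h \<in> below f" "s = p f - T h" by blast
    let ?g = "\<lambda>x. f x - h x"
    have g: "?g \<in> L" by (intro diff_mem f belowD(1)[OF h(1)])
    have "s = p ?g + q h"
      using p[OF g belowD(1)[OF h(1)]] q[OF belowD(1)[OF h(1)]] h(2) by simp
    moreover have "?g \<in> {g \<in> L. \<forall>x. 0 \<le> g x}" "h \<in> {g \<in> L. \<forall>x. 0 \<le> g x}"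
      using g belowD[OF h(1)] by auto
    moreover have "(\<lambda>x. ?g x + h x) = f" by simp
    ultimately show "s \<in> ?S" by blast
  qed
  moreover have "Inf ((\<lambda>h. p f - T h) ` below f) = p f - pos f"
  proof (rule cInf_eq_non_empty)
    show "(\<lambda>h. p f - T h) ` below f \<noteq> {}"
      using belowI[OF f(1,2) order_refl] by blast
    show "p f - pos f \<le> s" if "s \<in> (\<lambda>h. p f - T h) ` below f" for s
      using that pos_sup_upper[OF f(1)] pos_eq[OF f] by auto
    fix y assume y: "\<And>s. s \<in> (\<lambda>h. p f - T h) ` below f \<Longrightarrow> y \<le> s"
    have "pos_sup f \<le> p f - y"
    proof (rule pos_sup_least[OF f(2)])
      fix h assume "h \<in> below f"
      then have "y \<le> p f - T h" by (intro y imageI)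
      then show "T h \<le> p f - y" by simp
    qed
    then show "y \<le> p f - pos f" using pos_eq[OF f] by simp
  qed
  ultimately show ?thesis by simp
qed

end

lemma linear_functionalD:
  assumes "linear_functional A T"
  shows "f \<in> Lipc A \<Longrightarrow> g \<in> Lipc A \<Longrightarrow> T (\<lambda>x. f x + g x) = T f + T g"
    and "f \<in> Lipc A \<Longrightarrow> T (\<lambda>x. c * f x) = c * T f"
  using assms by (auto simp: linear_functional_def)

lemma functional_eq_on_pos:
  assumes "linear_functional A R" "linear_functional A S"
    and eq: "\<And>f. f \<in> Lipc_pos A \<Longrightarrow> R f = S f" and f: "f \<in> Lipc A"
  shows "R f = S f"
proof -
  interpret function_lattice "Lipc A" by (rule function_lattice_Lipc)
  let ?p = "\<lambda>x. max (f x) 0" and ?n = "\<lambda>x. max (- f x) 0"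
  have L: "?p \<in> Lipc A" "?n \<in> Lipc A" using f by (auto intro!: max_mem zero_mem uminus_mem)
  have fe: "f = (\<lambda>x. ?p x + (- 1) * ?n x)" by (auto simp: max_def)
  have "Q f = Q ?p + (- 1) * Q ?n" if "linear_functional A Q" for Q
    using linear_functionalD(1)[OF that L(1) scale_mem[OF L(2)], of "- 1"]
      linear_functionalD(2)[OF that L(2), of "- 1"] fe by metis
  moreover have "R ?p = S ?p" "R ?n = S ?n" using L by (auto intro!: eq simp: Lipc_pos_def)
  ultimately show ?thesis using assms(1,2) by metis
qed

lemma order_bounded_form_Lipc:
  assumes "linear_functional A T" "order_bounded A T"
  shows "order_bounded_form (Lipc A) T"
proof -
  interpret function_lattice "Lipc A" by (rule function_lattice_Lipc)
  show ?thesis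
  proof
    fix f assume f: "f \<in> Lipc A"
    have "bounded (T ` {g \<in> Lipc A. (\<lambda>x. 0) \<le> g \<and> g \<le> f})"
      using assms(2) f zero_mem by (auto simp: order_bounded_def)
    then have "bdd_above (T ` {g \<in> Lipc A. (\<lambda>x. 0) \<le> g \<and> g \<le> f})"
      by (rule bounded_imp_bdd_above)
    moreover have "{g \<in> Lipc A. (\<lambda>x. 0) \<le> g \<and> g \<le> f} = {g \<in> Lipc A. \<forall>x. 0 \<le> g x \<and> g x \<le> f x}"
      by (auto simp: le_fun_def)
    ultimately show "bdd_above (T ` {g \<in> Lipc A. \<forall>x. 0 \<le> g x \<and> g x \<le> f x})" by simp
  qed (rule linear_functionalD[OF assms(1)]; assumption)+
qed

text \<open>\<open>functional_abs\<close> is a definite description, so a bound on it says something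
  about \<open>pos\<close> only once the supremum has been identified and shown to be
  unique.\<close>

lemma functional_abs_eq:
  assumes "linear_functional A T" "order_bounded A T" and f: "f \<in> Lipc A"
  shows "functional_abs A T f = 2 * order_bounded_form.pos (Lipc A) T f - T f"
proof -
  interpret order_bounded_form "Lipc A" T by (rule order_bounded_form_Lipc[OF assms(1,2)])
  define R where "R = restrict (\<lambda>f. 2 * pos f - T f) (Lipc A)"
  have R: "R g = 2 * pos g - T g" if "g \<in> Lipc A" for g using that by (simp add: R_def)
  have lin: "linear_functional A R"
    by (auto simp: linear_functional_def R add_mem scale_mem pos_add pos_scale T_add T_scale algebra_simps)
  have R0: "0 \<le> R g" if "g \<in> Lipc A" "\<And>x. 0 \<le> g x" for g
    using pos_ge[OF that] pos_nonneg[OF that] by (simp add: R that)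
  have R_mono: "R g \<le> R h" if "g \<in> Lipc A" "h \<in> Lipc A" "g \<le> h" for g h
  proof -
    have "0 \<le> R (\<lambda>x. h x - g x)" using that by (intro R0 diff_mem) (auto simp: le_fun_def)
    then show ?thesis using that by (simp add: R diff_mem pos_diff T_diff)
  qed
  have ob: "order_bounded A R"
    unfolding order_bounded_def
  proof (intro ballI)
    fix u v assume "u \<in> Lipc A" "v \<in> Lipc A"
    then have "R ` {f \<in> Lipc A. u \<le> f \<and> f \<le> v} \<subseteq> {R u..R v}" by (auto intro: R_mono)
    then show "bounded (R ` {f \<in> Lipc A. u \<le> f \<and> f \<le> v})"
      using bounded_closed_interval bounded_subset by blast
  qed
  have least: "functional_le A R Q"
    if Q: "linear_functional A Q" "functional_le A T Q" "functional_le A (\<lambda>f. - T f) Q" for Q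
    unfolding functional_le_def
  proof
    fix g assume "g \<in> Lipc_pos A"
    then have g: "g \<in> Lipc A" "\<And>x. 0 \<le> g x" by (auto simp: Lipc_pos_def)
    \<comment> \<open>An upper bound \<open>Q\<close> of \<open>T\<close> and \<open>- T\<close>
      satisfies \<open>T h - T (g - h) \<le> Q g\<close> for each \<open>h\<close> between 0 and
      \<open>g\<close>; the left side is \<open>2 * T h - T g\<close>.\<close>
    have "pos_sup g \<le> (Q g + T g) / 2"
    proof (rule pos_sup_least[OF g(2)])
      fix h assume h: "h \<in> below g"
      let ?k = "\<lambda>x. g x - h x"
      have k: "?k \<in> Lipc A" by (intro diff_mem g belowD(1)[OF h])
      have "T h \<le> Q h" "- T ?k \<le> Q ?k"
        using Q h k belowD[OF h] by (auto simp: functional_le_def Lipc_pos_def)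
      moreover have "Q g = Q ?k + Q h"
        using linear_functionalD(1)[OF Q(1) k belowD(1)[OF h]] by simp
      moreover have "T ?k = T g - T h" by (intro T_diff g belowD(1)[OF h])
      ultimately show "T h \<le> (Q g + T g) / 2" by simp
    qed
    then show "R g \<le> Q g" using g by (simp add: R pos_eq)
  qed
  have sup: "is_functional_sup A T (\<lambda>f. - T f) R"
    unfolding is_functional_sup_def
  proof (intro conjI lin ob)
    show "functional_le A T R" "functional_le A (\<lambda>f. - T f) R"
      using pos_ge pos_nonneg by (auto simp: functional_le_def Lipc_pos_def R)
  qed (use least in blast)
  have "functional_abs A T = R"
    unfolding functional_abs_def
  proof (rule the_equality)
    show "R \<in> extensional (Lipc A) \<and> is_functional_sup A T (\<lambda>f. - T f) R"
      using sup by (simp add: R_def)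
    fix S assume S: "S \<in> extensional (Lipc A) \<and> is_functional_sup A T (\<lambda>f. - T f) S"
    then have "functional_le A S R" "functional_le A R S"
      using sup unfolding is_functional_sup_def by blast+
    then have eq_pos: "S g = R g" if "g \<in> Lipc_pos A" for g
      using that by (auto simp: functional_le_def intro: antisym)
    have "linear_functional A S" using S by (simp add: is_functional_sup_def)
    then have eq: "S g = R g" if "g \<in> Lipc A" for g
      using lin eq_pos that by (rule functional_eq_on_pos)
    show "S = R"
    proof (rule extensionalityI[of S "Lipc A" R])
      show "S \<in> extensional (Lipc A)" using S by blast
      show "R \<in> extensional (Lipc A)" by (simp add: R_def)
    qed (rule eq)
  qed
  then show ?thesis using f by (simp add: R)
qed

lemma (in boundedly_compact_pair) Lipc_integralI:
  assumes "\<And>f g. f \<in> Lipc A \<Longrightarrow> g \<in> Lipc A \<Longrightarrow> P (\<lambda>x. f x + g x) = P f + P g"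
    and "\<And>c f. f \<in> Lipc A \<Longrightarrow> P (\<lambda>x. c * f x) = c * P f"
    and "\<And>f. f \<in> Lipc A \<Longrightarrow> (\<And>x. 0 \<le> f x) \<Longrightarrow> 0 \<le> P f"
    and "\<And>u. (\<And>n. u n \<in> Lipc A) \<Longrightarrow> (\<And>x. decseq (\<lambda>n. u n x)) \<Longrightarrow>
      (\<And>x. (\<lambda>n. u n x) \<longlonglongrightarrow> 0) \<Longrightarrow> (\<lambda>n. P (u n)) \<longlonglongrightarrow> 0"
    and "bounded_functional A P"
  shows "Lipc_integral A P"
proof -
  interpret function_lattice "Lipc A" by (rule function_lattice_Lipc)
  show ?thesis
    by unfold_locales (use assms Lipc_min_one Lipc_bounded in auto)
qed

theorem theorem5p28:
  fixes A :: "'a::metric_space set"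
    and T :: "('a \<Rightarrow> real) \<Rightarrow> real"
  assumes "closed A" and "A \<noteq> {}"
    and "boundedly_compact A"
    and "linear_functional A T"
    and "order_bounded A T"
    and "seq_order_continuous A T"
    and "bounded_functional A T"
    and "bounded_functional A (functional_abs A T)"
  shows "(\<exists>\<mu>\<in>M1_plus A. \<exists>\<nu>\<in>M1_plus A. \<forall>f\<in>Lipc A. T f = rel_integral \<mu> f - rel_integral \<nu> f) \<and>
         (\<exists>!(\<mu>, \<nu>)\<in>M1_plus A \<times> M1_plus A.
            (\<forall>f\<in>Lipc A. T f = rel_integral \<mu> f - rel_integral \<nu> f) \<and>
            (\<forall>f\<in>Lipc_pos A.
               Inf {rel_integral \<mu> g + rel_integral \<nu> h | g h.
                      g \<in> Lipc_pos A \<and> h \<in> Lipc_pos A \<and> (\<lambda>x. g x + h x) = f} = 0))"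
proof -
  interpret boundedly_compact_pair A using assms(1-3) by unfold_locales
  interpret T: order_bounded_form "Lipc A" T by (rule order_bounded_form_Lipc[OF assms(4,5)])
  have T_cont: "(\<lambda>n. T (u n)) \<longlonglongrightarrow> 0"
    if "\<And>n. u n \<in> Lipc A" "\<And>x. decseq (\<lambda>n. u n x)" "\<And>x. (\<lambda>n. u n x) \<longlonglongrightarrow> 0" for u
    using assms(6) that order_null_decseq[OF that] unfolding seq_order_continuous_def by blast
  have pos_cont: "(\<lambda>n. T.pos (u n)) \<longlonglongrightarrow> 0"
    if "\<And>n. u n \<in> Lipc A" "\<And>x. decseq (\<lambda>n. u n x)" "\<And>x. (\<lambda>n. u n x) \<longlonglongrightarrow> 0" for u
    using T_cont that by (rule T.pos_decseq)
  define N where "N f = T.pos f - T f" for f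
  obtain M1 where M1: "\<And>f. f \<in> Lipc A \<Longrightarrow> \<bar>T f\<bar> \<le> M1 * lip_number f"
    using assms(7) by (auto simp: bounded_functional_def)
  obtain M2 where M2: "\<And>f. f \<in> Lipc A \<Longrightarrow> \<bar>2 * T.pos f - T f\<bar> \<le> M2 * lip_number f"
    using assms(8) by (auto simp: bounded_functional_def functional_abs_eq[OF assms(4,5)])
  \<comment> \<open>\<open>T.pos\<close> is half the sum, and \<open>N\<close> half the difference,
    of the modulus and \<open>T\<close>; hence the mean of the two bounds.\<close>
  have "\<bar>T.pos f\<bar> \<le> (M1 + M2) / 2 * lip_number f \<and> \<bar>N f\<bar> \<le> (M1 + M2) / 2 * lip_number f"
    if "f \<in> Lipc A" for f
    using M1[OF that] M2[OF that] by (auto simp: N_def algebra_simps abs_if split: if_splits)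
  then have bdd: "bounded_functional A T.pos" "bounded_functional A N"
    unfolding bounded_functional_def by blast+
  interpret P: Lipc_integral A T.pos
    using bdd(1) by (intro Lipc_integralI T.pos_add T.pos_scale T.pos_nonneg pos_cont)
  interpret N: Lipc_integral A N
  proof (rule Lipc_integralI)
    fix u assume u: "\<And>n. u n \<in> Lipc A" "\<And>x. decseq (\<lambda>n. u n x)" "\<And>x. (\<lambda>n. u n x) \<longlonglongrightarrow> 0"
    have "(\<lambda>n. T.pos (u n) - T (u n)) \<longlonglongrightarrow> 0 - 0" by (intro tendsto_diff pos_cont T_cont u)
    then show "(\<lambda>n. N (u n)) \<longlonglongrightarrow> 0" by (simp add: N_def)
  qed (use bdd(2) T.pos_ge in \<open>auto simp: N_def T.pos_add T.pos_scale T.T_add T.T_scale algebra_simps\<close>)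
  define cls where "cls \<mu> = rel_measure_rel A `` {\<mu>}" for \<mu> :: "'a measure"
  let ?\<mu> = "cls P.measure_rep" and ?\<nu> = "cls N.measure_rep"
  have mem: "?\<mu> \<in> M1_plus A" "?\<nu> \<in> M1_plus A"
    unfolding cls_def by (intro M1_plus_class P.M1_representative_measure_rep N.M1_representative_measure_rep)+
  have int: "rel_integral ?\<mu> f = T.pos f" "rel_integral ?\<nu> f = N f" if "f \<in> Lipc A" for f
    using that by (simp_all add: cls_def rel_integral_class P.M1_representative_measure_rep
        N.M1_representative_measure_rep P.integral_measure_rep N.integral_measure_rep)
  have rep: "\<forall>f\<in>Lipc A. T f = rel_integral ?\<mu> f - rel_integral ?\<nu> f"
    by (simp add: int N_def)
  have Lipc_pos_eq: "Lipc_pos A = {g \<in> Lipc A. \<forall>x. 0 \<le> g x}" by (simp add: Lipc_pos_def)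
  have rel_integral_add: "rel_integral M (\<lambda>x. f x + g x) = rel_integral M f + rel_integral M g"
    if M: "M \<in> M1_plus A" and fg: "f \<in> Lipc A" "g \<in> Lipc A" for M f g
  proof -
    obtain \<mu> where \<mu>: "M1_representative \<mu>" "M = rel_measure_rel A `` {\<mu>}" using M by (rule M1_plusE)
    have "(\<integral>x. f x + g x \<partial>\<mu>) = (\<integral>x. f x \<partial>\<mu>) + (\<integral>x. g x \<partial>\<mu>)"
      by (intro Bochner_Integration.integral_add M1_representative_integrable \<mu> fg)
    then show ?thesis by (simp add: \<mu>(2) rel_integral_class[OF \<mu>(1)] fg T.add_mem)
  qed
  \<comment> \<open>This holds for every pair that represents \<open>T\<close>, so it serves both
    existence and uniqueness.\<close>
  have Inf_eq: "Inf {rel_integral M g + rel_integral K h | g h.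
      g \<in> Lipc_pos A \<and> h \<in> Lipc_pos A \<and> (\<lambda>x. g x + h x) = f} = rel_integral M f - T.pos f"
    if "M \<in> M1_plus A" "\<forall>f\<in>Lipc A. T f = rel_integral M f - rel_integral K f" "f \<in> Lipc_pos A" for M K f
    unfolding Lipc_pos_eq using that rel_integral_add[OF that(1)]
    by (intro T.Inf_decomposition_eq) (auto simp: Lipc_pos_def)
  have class_eq: "M = M'"
    if M: "M \<in> M1_plus A" "M' \<in> M1_plus A"
      and eq: "\<And>f. f \<in> Lipc_pos A \<Longrightarrow> rel_integral M f = rel_integral M' f" for M M'
  proof -
    obtain \<mu> where \<mu>: "M1_representative \<mu>" "M = rel_measure_rel A `` {\<mu>}" using M(1) by (rule M1_plusE)
    obtain \<mu>' where \<mu>': "M1_representative \<mu>'" "M' = rel_measure_rel A `` {\<mu>'}" using M(2) by (rule M1_plusE)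
    have "(\<mu>, \<mu>') \<in> rel_measure_rel A"
      using eq unfolding \<mu>(2) \<mu>'(2)
      by (intro M1_representative_unique \<mu> \<mu>') (auto simp: rel_integral_class \<mu>(1) \<mu>'(1) Lipc_pos_def)
    then show ?thesis
      unfolding \<mu>(2) \<mu>'(2) by (rule equiv_class_eq[OF equiv_rel_measure_rel[OF closed_A]])
  qed
  show ?thesis
  proof (intro conjI)
    show "\<exists>\<mu>\<in>M1_plus A. \<exists>\<nu>\<in>M1_plus A. \<forall>f\<in>Lipc A. T f = rel_integral \<mu> f - rel_integral \<nu> f"
      using mem rep by blast
    have Inf0: "\<forall>f\<in>Lipc_pos A. Inf {rel_integral ?\<mu> g + rel_integral ?\<nu> h | g h.
        g \<in> Lipc_pos A \<and> h \<in> Lipc_pos A \<and> (\<lambda>x. g x + h x) = f} = 0"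
      using Inf_eq[OF mem(1) rep] int(1) by (simp add: Lipc_pos_def)
    have unique: "M = ?\<mu> \<and> K = ?\<nu>"
      if MK: "M \<in> M1_plus A" "K \<in> M1_plus A"
        and repMK: "\<forall>f\<in>Lipc A. T f = rel_integral M f - rel_integral K f"
        and Inf0: "\<forall>f\<in>Lipc_pos A. Inf {rel_integral M g + rel_integral K h | g h.
          g \<in> Lipc_pos A \<and> h \<in> Lipc_pos A \<and> (\<lambda>x. g x + h x) = f} = 0" for M K
    proof -
      \<comment> \<open>A vanishing infimum forces the first measure to represent
        \<open>T.pos\<close>; the representation of \<open>T\<close> then leaves \<open>N\<close>
        for the second one.\<close>
      have M: "rel_integral M f = T.pos f" if "f \<in> Lipc_pos A" for f
        using Inf_eq[OF MK(1) repMK that] bspec[OF Inf0 that] by simp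
      have L: "f \<in> Lipc A" if "f \<in> Lipc_pos A" for f using that by (simp add: Lipc_pos_def)
      have K: "rel_integral K f = N f" if "f \<in> Lipc_pos A" for f
        using M[OF that] bspec[OF repMK L[OF that]] by (simp add: N_def)
      show ?thesis
        using class_eq[OF MK(1) mem(1)] class_eq[OF MK(2) mem(2)] M K int L by simp
    qed
    show "\<exists>!(\<mu>, \<nu>)\<in>M1_plus A \<times> M1_plus A.
      (\<forall>f\<in>Lipc A. T f = rel_integral \<mu> f - rel_integral \<nu> f) \<and>
      (\<forall>f\<in>Lipc_pos A. Inf {rel_integral \<mu> g + rel_integral \<nu> h | g h.
         g \<in> Lipc_pos A \<and> h \<in> Lipc_pos A \<and> (\<lambda>x. g x + h x) = f} = 0)"
    proof (rule ex1I[of _ "(?\<mu>, ?\<nu>)"], goal_cases)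
      case 1
      show ?case using mem rep Inf0 by simp
    next
      case (2 z)
      obtain M K where z: "z = (M, K)" by (cases z)
      show ?case using 2 unique[of M K] unfolding z by blast
    qed
  qed
qed

end
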